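(* Let $A\ge 0$ and $Z\ge 0$ be $n\times n$ complex matrices, where $Z$ has extremal (largest and smallest) eigenvalues $a$ and $b$. Then for every symmetric norm $\|\cdot\|$ and every real $p>1$, $$\|A^pZ^pA^p\|-\|(AZA)^p\|\le C(a,b,p)\,\|A^{2p}\| .$$
   Context: $A\ge0$ means that $A$ is Hermitian positive semidefinite. A symmetric norm is a unitarily invariant norm on $n\times n$ complex matrices: $\|UXV\|=\|X\|$ for all matrices $X$ and all unitaries $U,V$. For reals $a\ge b\ge 0$ and $p>1$ the constant $C(a,b,p)$ is $$C(a,b,p)=(p-1)\left(\frac{a^p-b^p}{p(a-b)}\right)^{p/(p-1)}+\frac{ab^p-ba^p}{a-b}\quad (a\neq b),$$ and $C(a,a,p)=0$ (the limiting value). *)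

theory Defs
  imports
    Complex_Main
    "Jordan_Normal_Form.Matrix"
    "Jordan_Normal_Form.Char_Poly"
    "Jordan_Normal_Form.Schur_Decomposition"
begin

definition psd :: "nat \<Rightarrow> complex mat \<Rightarrow> bool" where
  "psd n A \<longleftrightarrow> A \<in> carrier_mat n n \<and> mat_adjoint A = A \<and>
     (\<forall>v \<in> carrier_vec n. 0 \<le> Re ((A *\<^sub>v v) \<bullet>c v))"

definition unitary :: "nat \<Rightarrow> complex mat \<Rightarrow> bool" where
  "unitary n U \<longleftrightarrow> U \<in> carrier_mat n n \<and>
     mat_adjoint U * U = 1\<^sub>m n \<and> U * mat_adjoint U = 1\<^sub>m n"

definition spectral_decomposition :: "nat \<Rightarrow> complex mat \<Rightarrow> complex mat \<Rightarrow> (nat \<Rightarrow> real) \<Rightarrow> bool" where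
  "spectral_decomposition n A U d \<longleftrightarrow>
     unitary n U \<and> A = U * mat_diag n (\<lambda>i. complex_of_real (d i)) * mat_adjoint U"

(* Functional calculus: if A = U diag(d) U* with d >= 0, then A^p = U diag(d^p) U*.  The result
   does not depend on the decomposition (mat_powr_eqI), and the spectral theorem provides one for
   every positive semidefinite A.  The value is only meaningful for such A.  For p > 0 the
   convention 0 powr p = 0 of the library is the right one. *)
definition mat_powr :: "complex mat \<Rightarrow> real \<Rightarrow> complex mat" where
  "mat_powr A p = (THE B. \<exists>U d. spectral_decomposition (dim_row A) A U d \<and>
     (\<forall>i < dim_row A. 0 \<le> d i) \<and> spectral_decomposition (dim_row A) B U (\<lambda>i. d i powr p))"

(* A norm on the space of n x n matrices only: N is unconstrained on matrices of other sizes. *)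
definition symmetric_norm :: "nat \<Rightarrow> (complex mat \<Rightarrow> real) \<Rightarrow> bool" where
  "symmetric_norm n N \<longleftrightarrow>
     (\<forall>X \<in> carrier_mat n n. 0 \<le> N X \<and> (N X = 0 \<longleftrightarrow> X = 0\<^sub>m n n)) \<and>
     (\<forall>X \<in> carrier_mat n n. \<forall>c. N (c \<cdot>\<^sub>m X) = cmod c * N X) \<and>
     (\<forall>X \<in> carrier_mat n n. \<forall>Y \<in> carrier_mat n n. N (X + Y) \<le> N X + N Y) \<and>
     (\<forall>X \<in> carrier_mat n n. \<forall>U V. unitary n U \<and> unitary n V \<longrightarrow> N (U * X * V) = N X)"

definition largest_eigenvalue :: "complex mat \<Rightarrow> real \<Rightarrow> bool" where
  "largest_eigenvalue Z a \<longleftrightarrow> eigenvalue Z (complex_of_real a) \<and>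
     (\<forall>x. eigenvalue Z (complex_of_real x) \<longrightarrow> x \<le> a)"

definition smallest_eigenvalue :: "complex mat \<Rightarrow> real \<Rightarrow> bool" where
  "smallest_eigenvalue Z b \<longleftrightarrow> eigenvalue Z (complex_of_real b) \<and>
     (\<forall>x. eigenvalue Z (complex_of_real x) \<longrightarrow> b \<le> x)"

definition C_const :: "real \<Rightarrow> real \<Rightarrow> real \<Rightarrow> real" where
  "C_const a b p = (if a = b then 0 else
     (p - 1) * ((a powr p - b powr p) / (p * (a - b))) powr (p / (p - 1)) +
     (a * b powr p - b * a powr p) / (a - b))"

lemma mat_adjoint_carrier: "U \<in> carrier_mat n m \<Longrightarrow> mat_adjoint U \<in> carrier_mat m n"
  by (auto simp: mat_adjoint_def)

lemma spectral_decomposition_fun_unique: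
  assumes U: "spectral_decomposition n A U d" and V: "spectral_decomposition n A V e"
  shows "U * mat_diag n (\<lambda>i. complex_of_real (f (d i))) * mat_adjoint U =
         V * mat_diag n (\<lambda>i. complex_of_real (f (e i))) * mat_adjoint V"
proof -
  have u: "U \<in> carrier_mat n n" "mat_adjoint U * U = 1\<^sub>m n" "U * mat_adjoint U = 1\<^sub>m n"
    and v: "V \<in> carrier_mat n n" "mat_adjoint V * V = 1\<^sub>m n" "V * mat_adjoint V = 1\<^sub>m n"
    using U V by (auto simp: spectral_decomposition_def unitary_def)
  define U' V' where "U' = mat_adjoint U" and "V' = mat_adjoint V"
  have c: "U' \<in> carrier_mat n n" "V' \<in> carrier_mat n n"
    using u v by (auto simp: U'_def V'_def intro: mat_adjoint_carrier)
  note u = u[folded U'_def] and v = v[folded V'_def]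
  define W where "W = V' * U"
  have W: "W \<in> carrier_mat n n" using c u by (auto simp: W_def)
  let ?D = "\<lambda>g. mat_diag n (\<lambda>i. complex_of_real (g i))"
  have D: "?D g \<in> carrier_mat n n" for g by simp
  have "U * ?D d * U' = V * ?D e * V'"
    using U V by (simp add: spectral_decomposition_def U'_def V'_def)
  hence "V' * (U * ?D d * U') * U = V' * (V * ?D e * V') * U" by simp
  moreover have "V' * (U * ?D d * U') * U = V' * U * ?D d * (U' * U)"
    using u(1) v(1) c D[of d] by (simp add: assoc_mult_mat[of _ n n _ n _ n] mult_carrier_mat[of _ n n _ n])
  moreover have "V' * (V * ?D e * V') * U = (V' * V) * ?D e * (V' * U)"
    using u(1) v(1) c D[of e] by (simp add: assoc_mult_mat[of _ n n _ n _ n] mult_carrier_mat[of _ n n _ n])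
  ultimately have WD: "W * ?D d = ?D e * W"
    using W D[of d] D[of e] u v by (simp add: W_def)
  have "W $$ (i,j) * complex_of_real (f (d j)) = complex_of_real (f (e i)) * W $$ (i,j)"
    if ij: "i < n" "j < n" for i j
  proof -
    have "(W * ?D d) $$ (i,j) = (?D e * W) $$ (i,j)" using WD by simp
    hence "W $$ (i,j) * complex_of_real (d j) = complex_of_real (e i) * W $$ (i,j)"
      using ij W by (simp add: mat_diag_mult_left[OF W] mat_diag_mult_right[OF W])
    thus ?thesis by (cases "W $$ (i,j) = 0") auto
  qed
  hence WF: "W * ?D (\<lambda>i. f (d i)) = ?D (\<lambda>i. f (e i)) * W"
    by (intro eq_matI) (auto simp: mat_diag_mult_left[OF W] mat_diag_mult_right[OF W])
  have VW: "V * W = U" using u v c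
    by (simp add: W_def assoc_mult_mat[of _ n n _ n _ n, symmetric] mult_carrier_mat[of _ n n _ n])
  have WU: "W * U' = V'" using u v c
    by (simp add: W_def assoc_mult_mat[of _ n n _ n _ n] mult_carrier_mat[of _ n n _ n])
  have "U * ?D (\<lambda>i. f (d i)) * U' = V * W * ?D (\<lambda>i. f (d i)) * U'" by (simp add: VW)
  also have "\<dots> = V * (W * ?D (\<lambda>i. f (d i))) * U'"
    using v(1) W D[of "\<lambda>i. f (d i)"] by (simp add: assoc_mult_mat[of _ n n _ n _ n] mult_carrier_mat[of _ n n _ n])
  also have "\<dots> = V * ?D (\<lambda>i. f (e i)) * (W * U')"
    using v(1) W c D[of "\<lambda>i. f (e i)"] by (simp add: WF assoc_mult_mat[of _ n n _ n _ n] mult_carrier_mat[of _ n n _ n])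
  finally show ?thesis unfolding WU unfolding U'_def V'_def .
qed

lemma mat_powr_eqI:
  assumes A: "spectral_decomposition n A U d" and nonneg: "\<And>i. i < n \<Longrightarrow> 0 \<le> d i"
  shows "mat_powr A p = U * mat_diag n (\<lambda>i. complex_of_real (d i powr p)) * mat_adjoint U"
proof -
  have "dim_row A = n" and U: "unitary n U"
    using A by (auto simp: spectral_decomposition_def unitary_def)
  thus ?thesis unfolding mat_powr_def
  proof (intro the_equality, goal_cases)
    case 1
    thus ?case using A nonneg by (auto simp: spectral_decomposition_def)
  next
    case (2 B)
    then obtain V e where "spectral_decomposition n A V e"
      and "B = V * mat_diag n (\<lambda>i. complex_of_real (e i powr p)) * mat_adjoint V"
      by (auto simp: spectral_decomposition_def)
    thus ?case using spectral_decomposition_fun_unique[OF A, of V e "\<lambda>x. x powr p"] by simp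
  qed
qed

end

theory Submission
  imports Defs "HOL-Analysis.Convex"
begin

text \<open>
  Let $\alpha t + \beta$ be the chord of $t^p$ over $[b, a]$, so that $Z^p \le \alpha Z + \beta$.
  Put $Y = AZA$ and $S = A^{p-1}$; then
  $X = A^p Z^p A^p \le \alpha\, S Y S + \beta A^{2p}$.
  Given $k$, take an orthonormal basis $f_1, \dots, f_k$ of the span of the first $k$ eigenvectors of
  $X$ in which the compression of $S^2$ is diagonal, with entries $m_i$. The vectors $S f_i$ are then
  orthogonal, and for the normalised vectors $u_i$ and $v_i = \langle u_i, Y u_i\rangle$, Young's
  inequality gives
  $\alpha m_i v_i \le v_i^p + (p-1)(\alpha/p)^{p/(p-1)}\, m_i^{p/(p-1)}$.
  By Jensen's inequality $v_i^p \le \langle u_i, Y^p u_i\rangle$ and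
  $m_i^{p/(p-1)} \le \langle f_i, A^{2p} f_i\rangle$, so Ky Fan's maximum principle bounds the sum of
  the $k$ largest eigenvalues of $X$ by that of $Y^p$ plus
  $C(a,b,p) = (p-1)(\alpha/p)^{p/(p-1)} + \beta$ times that of $A^{2p}$.
  Ky Fan's dominance principle carries this weak majorization over to every symmetric norm.
\<close>

section \<open>Adjoints, unitary and block diagonal matrices\<close>

lemma dim_mat_adjoint [simp]:
  "dim_row (mat_adjoint A) = dim_col A" "dim_col (mat_adjoint A) = dim_row A"
  by (simp_all add: mat_adjoint_def)

lemma index_mat_adjoint [simp]:
  "i < dim_col A \<Longrightarrow> j < dim_row A \<Longrightarrow> mat_adjoint A $$ (i, j) = conjugate (A $$ (j, i))"
  by (simp add: mat_adjoint_def mat_of_rows_def)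

lemma mat_adjoint_adjoint [simp]:
  "mat_adjoint (mat_adjoint A) = A"
  by (rule eq_matI) auto

lemma mat_adjoint_mult:
  fixes A B :: "'a :: conjugatable_field mat"
  assumes "A \<in> carrier_mat n m" "B \<in> carrier_mat m k"
  shows "mat_adjoint (A * B) = mat_adjoint B * mat_adjoint A"
  using assms
  by (intro eq_matI) (auto simp: scalar_prod_def sum_conjugate conjugate_dist_mul intro!: sum.cong)

lemma mat_adjoint_mat_diag [simp]:
  "mat_adjoint (mat_diag n f) = mat_diag n (\<lambda>i. conjugate (f i :: 'a :: conjugatable_field))"
  by (intro eq_matI) (auto simp: mat_diag_def)

lemma mat_adjoint_one [simp]: "mat_adjoint (1\<^sub>m n :: complex mat) = 1\<^sub>m n"
  by (intro eq_matI) auto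

lemma unitary_carrier [dest]: "unitary n U \<Longrightarrow> U \<in> carrier_mat n n"
  by (simp add: unitary_def)

lemma unitary_carrier_adjoint: "unitary n U \<Longrightarrow> mat_adjoint U \<in> carrier_mat n n"
  by (simp add: unitary_def mat_adjoint_carrier)

lemma unitary_left: "unitary n U \<Longrightarrow> mat_adjoint U * U = 1\<^sub>m n"
  and unitary_right: "unitary n U \<Longrightarrow> U * mat_adjoint U = 1\<^sub>m n"
  by (simp_all add: unitary_def)

text \<open>A one-sided inverse of a square matrix is two-sided, so orthonormality of the columns is
  enough.\<close>

lemma unitaryI:
  assumes "U \<in> carrier_mat n n" "mat_adjoint U * U = 1\<^sub>m n"
  shows "unitary n U"
  using assms mat_mult_left_right_inverse[OF _ assms(1) assms(2)]
  by (simp add: unitary_def mat_adjoint_carrier)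

lemma unitary_adjoint: "unitary n U \<Longrightarrow> unitary n (mat_adjoint U)"
  by (simp add: unitary_def mat_adjoint_carrier)

lemma unitary_one [simp]: "unitary n (1\<^sub>m n)"
  by (rule unitaryI) auto

lemmas square_assoc = assoc_mult_mat[of _ n n _ n _ n] for n
lemmas square_mult = mult_carrier_mat[of _ n n _ n] for n

lemma square_mult_cancel_left:
  assumes "A * B = 1\<^sub>m n" "A \<in> carrier_mat n n" "B \<in> carrier_mat n n" "C \<in> carrier_mat n n"
  shows "A * (B * C) = (C :: 'a :: semiring_1 mat)"
  using assms by (simp flip: square_assoc[where n=n])

lemma unitary_mult:
  assumes U: "unitary n U" and V: "unitary n V"
  shows "unitary n (U * V)"
proof (rule unitaryI)
  note c = unitary_carrier[OF U] unitary_carrier[OF V] unitary_carrier_adjoint[OF U] unitary_carrier_adjoint[OF V]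
  show "U * V \<in> carrier_mat n n" using c by simp
  show "mat_adjoint (U * V) * (U * V) = 1\<^sub>m n"
    using c unitary_left[OF U] unitary_left[OF V]
    by (simp add: mat_adjoint_mult[of _ n n _ n] square_assoc[where n=n] square_mult[where n=n] square_mult_cancel_left[where n=n])
qed

section \<open>Block diagonal matrices\<close>

lemma mat_adjoint_four_block:
  assumes "A \<in> carrier_mat n1 m1" "B \<in> carrier_mat n1 m2" "C \<in> carrier_mat n2 m1" "D \<in> carrier_mat n2 m2"
  shows "mat_adjoint (four_block_mat A B C D) =
    four_block_mat (mat_adjoint A) (mat_adjoint C) (mat_adjoint B) (mat_adjoint D)"
  using assms by (intro eq_matI) auto

abbreviation block_diag :: "nat \<Rightarrow> nat \<Rightarrow> complex mat \<Rightarrow> complex mat \<Rightarrow> complex mat" where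
  "block_diag k l A D \<equiv> four_block_mat A (0\<^sub>m k l) (0\<^sub>m l k) D"

lemma block_diag_mult:
  assumes "A \<in> carrier_mat k k" "A' \<in> carrier_mat k k" "D \<in> carrier_mat l l" "D' \<in> carrier_mat l l"
  shows "block_diag k l A D * block_diag k l A' D' = block_diag k l (A * A') (D * D')"
  using assms by (subst mult_four_block_mat[of _ k k _ l _ l _ _ k _ l]) auto

lemma mat_adjoint_block_diag:
  assumes "A \<in> carrier_mat k k" "D \<in> carrier_mat l l"
  shows "mat_adjoint (block_diag k l A D) = block_diag k l (mat_adjoint A) (mat_adjoint D)"
proof -
  have "mat_adjoint (0\<^sub>m k l :: complex mat) = 0\<^sub>m l k" "mat_adjoint (0\<^sub>m l k :: complex mat) = 0\<^sub>m k l"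
    by (intro eq_matI; auto)+
  thus ?thesis using mat_adjoint_four_block[OF assms(1) _ _ assms(2), of "0\<^sub>m k l" "0\<^sub>m l k"] by simp
qed

lemma one_mat_block: "block_diag k l (1\<^sub>m k) (1\<^sub>m l) = 1\<^sub>m (k + l)"
  by (intro eq_matI) auto

lemma unitary_block_diag:
  assumes U: "unitary k U" and V: "unitary l V"
  shows "unitary (k + l) (block_diag k l U V)"
proof (rule unitaryI)
  note c = unitary_carrier[OF U] unitary_carrier[OF V] unitary_carrier_adjoint[OF U] unitary_carrier_adjoint[OF V]
  show "block_diag k l U V \<in> carrier_mat (k + l) (k + l)" using c by simp
  show "mat_adjoint (block_diag k l U V) * block_diag k l U V = 1\<^sub>m (k + l)"
    by (simp add: c unitary_left[OF U] unitary_left[OF V] mat_adjoint_block_diag block_diag_mult one_mat_block)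
qed

lemma mat_diag_block:
  "block_diag 1 n (mat 1 1 (\<lambda>_. e)) (mat_diag n f) = mat_diag (Suc n) (\<lambda>i. case i of 0 \<Rightarrow> e | Suc j \<Rightarrow> f j)"
  by (intro eq_matI) (auto simp: mat_diag_def split: nat.splits)

section \<open>The spectral theorem\<close>

text \<open>Complete \<open>v\<close> to a basis and orthogonalise it by Gram-Schmidt, which keeps
  \<open>v\<close> in front. The resulting columns are orthogonal but not of length one, so each is
  divided by its norm; hence the first column is only a multiple of \<open>v\<close>.\<close>

lemma unitary_with_first_column:
  fixes v :: "complex vec"
  assumes v: "v \<in> carrier_vec n" and v0: "v \<noteq> 0\<^sub>v n"
  obtains W c where "unitary n W" "col W 0 = c \<cdot>\<^sub>v v"
proof -
  from v v0 have n: "n \<noteq> 0" by auto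
  define b where "b = basis_completion v"
  define ws where "ws = gram_schmidt n b"
  define W where "W = mat_of_cols n ws"
  interpret cof_vec_space n "TYPE(complex)" .
  from basis_completion[OF v v0, folded b_def]
  have dist_b: "distinct b" and indep: "\<not> lin_dep (set b)" and b: "set b \<subseteq> carrier_vec n"
    and hdb: "hd b = v" and len_b: "length b = n" by auto
  from hdb len_b n obtain vs where bv: "b = v # vs" by (cases b) auto
  from gram_schmidt_result[OF b dist_b indep refl, folded ws_def]
  have ws: "set ws \<subseteq> carrier_vec n" "corthogonal ws" "length ws = n" by (auto simp: len_b)
  from gram_schmidt_hd[OF v, of vs, folded bv] have hdws: "hd ws = v" unfolding ws_def .
  have orth: "corthogonal_mat W" using orthogonal_mat_of_cols ws unfolding W_def .
  have W: "W \<in> carrier_mat n n"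
    using ws unfolding W_def using mat_of_cols_carrier(1)[of n ws] by auto
  have sp: "col W i \<bullet>c col W j = (\<Sum>l<n. W $$ (l, i) * cnj (W $$ (l, j)))" if "i < n" "j < n" for i j
    using W that by (simp add: scalar_prod_def atLeast0LessThan)
  define s where "s i = (\<Sum>l<n. (cmod (W $$ (l, i)))\<^sup>2)" for i
  have s: "col W i \<bullet>c col W i = complex_of_real (s i)" if "i < n" for i
    unfolding sp[OF that that] s_def by (simp add: complex_norm_square[symmetric] del: of_real_power)
  \<comment> \<open>\<open>corthogonal_mat\<close> also excludes zero columns, so the normalisation
    divides by positive numbers.\<close>
  have spos: "s i > 0" if "i < n" for i
  proof -
    have "s i \<noteq> 0" using corthogonal_matD[OF orth, of i i] that W s[OF that] by auto
    moreover have "s i \<ge> 0" unfolding s_def by (intro sum_nonneg) auto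
    ultimately show ?thesis by simp
  qed
  define V where "V = mat n n (\<lambda>(i, j). W $$ (i, j) / complex_of_real (sqrt (s j)))"
  have V: "V \<in> carrier_mat n n" by (simp add: V_def)
  have "(mat_adjoint V * V) $$ (i, j) = 1\<^sub>m n $$ (i, j)" if ij: "i < n" "j < n" for i j
  proof -
    have "(mat_adjoint V * V) $$ (i, j) =
        (\<Sum>l<n. W $$ (l, j) * cnj (W $$ (l, i))) / (complex_of_real (sqrt (s i)) * complex_of_real (sqrt (s j)))"
      using ij by (simp add: V_def scalar_prod_def sum_divide_distrib atLeast0LessThan mult.commute)
    also have "\<dots> = (col W j \<bullet>c col W i) / (complex_of_real (sqrt (s i)) * complex_of_real (sqrt (s j)))"
      using sp ij by simp
    also have "\<dots> = (if i = j then 1 else 0)"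
    proof (cases "i = j")
      case True
      have "complex_of_real (sqrt (s j)) * complex_of_real (sqrt (s j)) = complex_of_real (s j)"
        using spos[OF ij(2)] by (simp flip: of_real_mult)
      thus ?thesis using True s[OF ij(2)] spos[OF ij(2)] by simp
    next
      case False
      thus ?thesis using corthogonal_matD[OF orth, of j i] ij W by simp
    qed
    finally show ?thesis using ij by simp
  qed
  hence "mat_adjoint V * V = 1\<^sub>m n" by (intro eq_matI) (use V in auto)
  with V have "unitary n V" by (rule unitaryI)
  moreover have "col W 0 = v"
    using ws hdws n unfolding W_def by (metis col_mat_of_cols hd_conv_nth length_0_conv nth_mem subsetD bot_nat_0.not_eq_extremum)
  hence "col V 0 = (1 / complex_of_real (sqrt (s 0))) \<cdot>\<^sub>v v"
    using n W by (intro eq_vecI) (auto simp: V_def)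
  ultimately show thesis by (rule that)
qed

lemma exists_eigenvector:
  fixes H :: "complex mat"
  assumes H: "H \<in> carrier_mat n n" and n: "n \<noteq> 0"
  obtains v e where "eigenvector H v e"
proof -
  obtain es where es: "char_poly H = (\<Prod>a\<leftarrow>es. [:- a, 1:])" "length es = n"
    using char_poly_factorized[OF H] by auto
  then obtain e where "e \<in> set es" using n by (cases es) auto
  hence "poly (char_poly H) e = 0" unfolding es(1) by (simp add: poly_prod_list prod_list_zero_iff)
  hence "eigenvalue H e" using eigenvalue_root_char_poly[OF H] by simp
  thus thesis using that unfolding eigenvalue_def by blast
qed

lemma spectral_decompositionD:
  assumes "spectral_decomposition n H U d"
  shows "unitary n U" "U \<in> carrier_mat n n" "mat_adjoint U \<in> carrier_mat n n" "H \<in> carrier_mat n n"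
    "H = U * mat_diag n (\<lambda>i. complex_of_real (d i)) * mat_adjoint U"
    "mat_adjoint H = H"
proof -
  show U: "unitary n U" and H: "H = U * mat_diag n (\<lambda>i. complex_of_real (d i)) * mat_adjoint U"
    using assms by (auto simp: spectral_decomposition_def)
  show c: "U \<in> carrier_mat n n" "mat_adjoint U \<in> carrier_mat n n"
    using U by (auto intro: unitary_carrier_adjoint)
  show "H \<in> carrier_mat n n" using c by (simp add: H square_mult[where n=n])
  show "mat_adjoint H = H" using c
    by (simp add: H mat_adjoint_mult[of _ n n _ n] square_mult[where n=n] square_assoc[where n=n])
qed

text \<open>Deflation by induction on the dimension: in an orthonormal basis that starts with an
  eigenvector, a Hermitian matrix splits into a \<open>1\<close>-by-\<open>1\<close> block and a
  smaller Hermitian block.\<close>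

theorem hermitian_spectral_decomposition:
  assumes "H \<in> carrier_mat n n" "mat_adjoint H = H"
  shows "\<exists>U d. spectral_decomposition n H U d"
  using assms
proof (induction n arbitrary: H)
  case 0
  have "spectral_decomposition 0 H (1\<^sub>m 0) (\<lambda>_. 0)"
    unfolding spectral_decomposition_def using 0 by (auto intro!: eq_matI)
  thus ?case by blast
next
  case (Suc n)
  let ?n = "Suc n"
  note H = Suc.prems(1)
  obtain v e where "eigenvector H v e" using exists_eigenvector[OF H] by auto
  hence v: "v \<in> carrier_vec ?n" "v \<noteq> 0\<^sub>v ?n" "H *\<^sub>v v = e \<cdot>\<^sub>v v"
    using H by (auto simp: eigenvector_def)
  obtain W c where W: "unitary ?n W" "col W 0 = c \<cdot>\<^sub>v v"
    using unitary_with_first_column[OF v(1,2)] by blast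
  have Wc: "W \<in> carrier_mat ?n ?n" "mat_adjoint W \<in> carrier_mat ?n ?n"
    using W by (auto intro: unitary_carrier_adjoint)
  define M where "M = mat_adjoint W * (H * W)"
  have Mc: "M \<in> carrier_mat ?n ?n" using Wc H by (simp add: M_def)
  have MH: "mat_adjoint M = M"
    using Wc H Suc.prems(2)
    by (simp add: M_def mat_adjoint_mult[of _ ?n ?n _ ?n] square_mult[where n="?n"] square_assoc[where n="?n"])
  have HW: "(H * W) $$ (l, 0) = e * W $$ (l, 0)" if "l < ?n" for l
  proof -
    have "(H * W) $$ (l, 0) = (H *\<^sub>v col W 0) $ l" using that H Wc by simp
    also have "H *\<^sub>v col W 0 = e \<cdot>\<^sub>v col W 0"
      using H v by (simp add: W(2) mult_mat_vec smult_smult_assoc mult.commute)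
    also have "(e \<cdot>\<^sub>v col W 0) $ l = e * W $$ (l, 0)" using that Wc by simp
    finally show ?thesis .
  qed
  \<comment> \<open>The first column of \<open>H * W\<close> is \<open>e\<close> times that of
    \<open>W\<close>, and \<open>mat_adjoint W * W\<close> is the identity. The first row then
    follows because \<open>M\<close> is Hermitian.\<close>
  have M0: "M $$ (i, 0) = (if i = 0 then e else 0)" if "i < ?n" for i
  proof -
    have "M $$ (i, 0) = (\<Sum>l\<in>{0..<?n}. mat_adjoint W $$ (i, l) * (H * W) $$ (l, 0))"
      unfolding M_def using that H Wc by (subst index_mult_mat) (auto simp: scalar_prod_def)
    also have "\<dots> = e * (\<Sum>l\<in>{0..<?n}. mat_adjoint W $$ (i, l) * W $$ (l, 0))"
      unfolding sum_distrib_left by (rule sum.cong) (use HW in auto)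
    also have "(\<Sum>l\<in>{0..<?n}. mat_adjoint W $$ (i, l) * W $$ (l, 0)) = (mat_adjoint W * W) $$ (i, 0)"
      using that Wc by (simp add: scalar_prod_def)
    also have "mat_adjoint W * W = 1\<^sub>m ?n" by (rule unitary_left[OF W(1)])
    finally show ?thesis using that by simp
  qed
  have M0': "M $$ (0, j) = cnj (M $$ (j, 0))" if "j < ?n" for j
    using arg_cong[OF MH, of "\<lambda>A. A $$ (0, j)"] that Mc by simp
  \<comment> \<open>The corner entry of a Hermitian matrix equals its own conjugate.\<close>
  have e: "e = complex_of_real (Re e)"
    using M0'[of 0] M0[of 0] by (simp add: complex_eq_iff)
  define H' where "H' = mat n n (\<lambda>(i, j). M $$ (Suc i, Suc j))"
  have H'c: "H' \<in> carrier_mat n n" by (simp add: H'_def)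
  have MHij: "cnj (M $$ (j, i)) = M $$ (i, j)" if "i < ?n" "j < ?n" for i j
    using arg_cong[OF MH, of "\<lambda>A. A $$ (i, j)"] that Mc by simp
  have "mat_adjoint H' = H'"
    by (intro eq_matI) (auto simp: H'_def MHij)
  from Suc.IH[OF H'c this] obtain U' d' where U': "spectral_decomposition n H' U' d'" by blast
  note U'D = spectral_decompositionD[OF U']
  define B where "B = block_diag 1 n (1\<^sub>m 1) U'"
  have B: "unitary ?n B" using unitary_block_diag[OF unitary_one U'D(1), of 1] by (simp add: B_def)
  have Bc: "B \<in> carrier_mat ?n ?n" "mat_adjoint B \<in> carrier_mat ?n ?n"
    using B by (auto intro: unitary_carrier_adjoint)
  define d where "d i = (case i of 0 \<Rightarrow> Re e | Suc j \<Rightarrow> d' j)" for i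
  let ?D = "mat_diag ?n (\<lambda>i. complex_of_real (d i))"
  have D: "?D = block_diag 1 n (mat 1 1 (\<lambda>_. e)) (mat_diag n (\<lambda>i. complex_of_real (d' i)))"
    unfolding mat_diag_block by (intro eq_matI) (auto simp: mat_diag_def d_def e[symmetric] split: nat.splits)
  have M: "M = block_diag 1 n (mat 1 1 (\<lambda>_. e)) H'"
    by (intro eq_matI) (use Mc M0 M0' e in \<open>auto simp: H'_def complex_eq_iff split: nat.splits\<close>)
  also have "\<dots> = B * ?D * mat_adjoint B"
    unfolding D B_def using U'D(2,3)
    by (simp add: mat_adjoint_block_diag block_diag_mult square_mult[where n=n] U'D(5)[symmetric])
  finally have "M = B * ?D * mat_adjoint B" .
  hence "W * M * mat_adjoint W = W * (B * ?D * mat_adjoint B) * mat_adjoint W" by simp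
  also have "W * M * mat_adjoint W = H"
    using Wc H unitary_right[OF W(1)] unfolding M_def
    by (simp add: square_mult[where n="?n"] square_assoc[where n="?n"] square_mult_cancel_left[where n="?n"])
  also have "W * (B * ?D * mat_adjoint B) * mat_adjoint W = (W * B) * ?D * mat_adjoint (W * B)"
    using Wc Bc by (simp add: mat_adjoint_mult[of _ ?n ?n _ ?n] square_mult[where n="?n"] square_assoc[where n="?n"])
  finally have "spectral_decomposition ?n H (W * B) d"
    unfolding spectral_decomposition_def using unitary_mult[OF W(1) B] by blast
  thus ?case by blast
qed

section \<open>Positive semidefinite matrices and quadratic forms\<close>

text \<open>Reordering the eigenvectors along with the eigenvalues only permutes the terms of the
  sum over eigenvectors. It serves both to sort spectra and to show that symmetric norms ignore the
  order of a diagonal.\<close>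

lemma spectral_decomposition_permute:
  assumes U: "spectral_decomposition n H U d" and \<sigma>: "bij_betw \<sigma> {..<n} {..<n}"
  shows "spectral_decomposition n H (mat n n (\<lambda>(i, j). U $$ (i, \<sigma> j))) (\<lambda>j. d (\<sigma> j))"
proof -
  note D = spectral_decompositionD[OF U]
  let ?V = "mat n n (\<lambda>(i, j). U $$ (i, \<sigma> j))"
  have less: "\<sigma> j < n" if "j < n" for j using bij_betwE[OF \<sigma>] that by auto
  have eq: "\<sigma> i = \<sigma> j \<longleftrightarrow> i = j" if "i < n" "j < n" for i j
    using inj_onD[OF bij_betw_imp_inj_on[OF \<sigma>], of i j] that by auto
  have "(mat_adjoint ?V * ?V) $$ (i, j) = 1\<^sub>m n $$ (i, j)" if "i < n" "j < n" for i j
  proof -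
    have "(mat_adjoint ?V * ?V) $$ (i, j) = (mat_adjoint U * U) $$ (\<sigma> i, \<sigma> j)"
      using that less D by (simp add: scalar_prod_def)
    thus ?thesis using that less eq by (simp add: unitary_left[OF D(1)])
  qed
  hence V: "unitary n ?V" by (intro unitaryI eq_matI) auto
  moreover have "H = ?V * mat_diag n (\<lambda>j. complex_of_real (d (\<sigma> j))) * mat_adjoint ?V"
  proof (rule eq_matI)
    fix i j
    assume "i < dim_row (?V * mat_diag n (\<lambda>j. complex_of_real (d (\<sigma> j))) * mat_adjoint ?V)"
      "j < dim_col (?V * mat_diag n (\<lambda>j. complex_of_real (d (\<sigma> j))) * mat_adjoint ?V)"
    hence ij: "i < n" "j < n" by auto
    have "H $$ (i, j) = (U * mat_diag n (\<lambda>l. complex_of_real (d l)) * mat_adjoint U) $$ (i, j)"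
      by (simp flip: D(5))
    also have "\<dots> = (\<Sum>l<n. U $$ (i, l) * d l * cnj (U $$ (j, l)))"
      using ij D(2) by (simp add: mat_diag_mult_right[OF D(2)] scalar_prod_def atLeast0LessThan)
    also have "\<dots> = (\<Sum>l<n. U $$ (i, \<sigma> l) * d (\<sigma> l) * cnj (U $$ (j, \<sigma> l)))"
      using sum.reindex_bij_betw[OF \<sigma>, of "\<lambda>l. U $$ (i, l) * d l * cnj (U $$ (j, l))"] by simp
    also have "\<dots> = (?V * mat_diag n (\<lambda>j. complex_of_real (d (\<sigma> j))) * mat_adjoint ?V) $$ (i, j)"
      using ij by (simp add: mat_diag_mult_right[of _ n] scalar_prod_def atLeast0LessThan)
    finally show "H $$ (i, j) = (?V * mat_diag n (\<lambda>j. complex_of_real (d (\<sigma> j))) * mat_adjoint ?V) $$ (i, j)" .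
  qed (use D(4) in auto)
  ultimately show ?thesis by (simp add: spectral_decomposition_def)
qed

lemma exists_decreasing_rearrangement:
  fixes d :: "nat \<Rightarrow> 'a :: linordered_ab_group_add"
  obtains \<sigma> where "bij_betw \<sigma> {..<n} {..<n}" "\<And>i j. i \<le> j \<Longrightarrow> j < n \<Longrightarrow> d (\<sigma> j) \<le> d (\<sigma> i)"
proof
  let ?xs = "sort_key (\<lambda>i. - d i) [0..<n]"
  show "bij_betw (\<lambda>i. ?xs ! i) {..<n} {..<n}"
    by (rule bij_betw_nth) (auto simp: distinct_sort)
  fix i j :: nat
  assume "i \<le> j" "j < n"
  moreover have "sorted (map (\<lambda>i. - d i) ?xs)" by simp
  ultimately show "d (?xs ! j) \<le> d (?xs ! i)"
    by (fastforce simp: sorted_iff_nth_mono)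
qed

lemma hermitian_sorted_decomposition:
  assumes "H \<in> carrier_mat n n" "mat_adjoint H = H"
  obtains U d where "spectral_decomposition n H U d" "\<And>i j. i \<le> j \<Longrightarrow> j < n \<Longrightarrow> d j \<le> d i"
proof -
  obtain U d where U: "spectral_decomposition n H U d"
    using hermitian_spectral_decomposition[OF assms] by blast
  obtain \<sigma> where "bij_betw \<sigma> {..<n} {..<n}" "\<And>i j. i \<le> j \<Longrightarrow> j < n \<Longrightarrow> d (\<sigma> j) \<le> d (\<sigma> i)"
    using exists_decreasing_rearrangement by blast
  thus thesis using spectral_decomposition_permute[OF U] that by blast
qed

lemma mat_adjoint_scalar_prod:
  fixes A :: "complex mat"
  assumes "A \<in> carrier_mat n m" "w \<in> carrier_vec n" "v \<in> carrier_vec m"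
  shows "(mat_adjoint A *\<^sub>v w) \<bullet>c v = w \<bullet>c (A *\<^sub>v v)"
proof -
  have "(mat_adjoint A *\<^sub>v w) \<bullet>c v = (\<Sum>i<m. \<Sum>l<n. cnj (A $$ (l, i)) * w $ l * cnj (v $ i))"
    using assms by (simp add: scalar_prod_def atLeast0LessThan sum_distrib_right)
  also have "\<dots> = (\<Sum>l<n. \<Sum>i<m. cnj (A $$ (l, i)) * w $ l * cnj (v $ i))"
    by (rule sum.swap)
  also have "\<dots> = w \<bullet>c (A *\<^sub>v v)"
    using assms by (simp add: scalar_prod_def atLeast0LessThan sum_distrib_left mult_ac)
  finally show ?thesis .
qed

lemma psd_congruence:
  assumes H: "psd n H" and T: "T \<in> carrier_mat n n"
  shows "psd n (mat_adjoint T * H * T)"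
  unfolding psd_def
proof (intro conjI ballI)
  have c: "H \<in> carrier_mat n n" "mat_adjoint T \<in> carrier_mat n n" and HH: "mat_adjoint H = H"
    using H T by (auto simp: psd_def mat_adjoint_carrier)
  show "mat_adjoint T * H * T \<in> carrier_mat n n" using c T by simp
  show "mat_adjoint (mat_adjoint T * H * T) = mat_adjoint T * H * T"
    using c T HH
    by (simp add: mat_adjoint_mult[of _ n n _ n] square_mult[where n=n] square_assoc[where n=n])
  fix v :: "complex vec" assume v: "v \<in> carrier_vec n"
  have "(mat_adjoint T * H * T) *\<^sub>v v = mat_adjoint T *\<^sub>v (H *\<^sub>v (T *\<^sub>v v))"
    using c T v by (simp add: assoc_mult_mat_vec[of _ n n _ n] square_mult[where n=n])
  hence "((mat_adjoint T * H * T) *\<^sub>v v) \<bullet>c v = (H *\<^sub>v (T *\<^sub>v v)) \<bullet>c (T *\<^sub>v v)"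
    using c T v by (simp add: mat_adjoint_scalar_prod[of _ n n])
  thus "0 \<le> Re (((mat_adjoint T * H * T) *\<^sub>v v) \<bullet>c v)"
    using H T v by (simp add: psd_def)
qed

lemma psd_mat_diag:
  assumes "\<And>i. i < n \<Longrightarrow> 0 \<le> d i"
  shows "psd n (mat_diag n (\<lambda>i. complex_of_real (d i)))"
  unfolding psd_def
proof (intro conjI ballI)
  fix v :: "complex vec" assume v: "v \<in> carrier_vec n"
  have "mat_diag n (\<lambda>i. complex_of_real (d i)) *\<^sub>v v = vec n (\<lambda>i. complex_of_real (d i) * v $ i)"
    using v by (intro eq_vecI) (auto simp: mat_diag_def scalar_prod_def if_distrib[of "\<lambda>x. x * _"] cong: if_cong)
  hence "(mat_diag n (\<lambda>i. complex_of_real (d i)) *\<^sub>v v) \<bullet>c v = (\<Sum>i<n. complex_of_real (d i) * (v $ i * cnj (v $ i)))"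
    using v by (simp add: scalar_prod_def atLeast0LessThan mult_ac)
  also have "\<dots> = complex_of_real (\<Sum>i<n. d i * (cmod (v $ i))\<^sup>2)"
    by (simp add: complex_norm_square[symmetric] del: of_real_power)
  finally show "0 \<le> Re ((mat_diag n (\<lambda>i. complex_of_real (d i)) *\<^sub>v v) \<bullet>c v)"
    using assms by (auto intro!: sum_nonneg)
qed auto

lemma spectral_decomposition_psd:
  assumes U: "spectral_decomposition n H U d" and d: "\<And>i. i < n \<Longrightarrow> 0 \<le> d i"
  shows "psd n H"
proof -
  note D = spectral_decompositionD[OF U]
  have "psd n (mat_adjoint (mat_adjoint U) * mat_diag n (\<lambda>i. complex_of_real (d i)) * mat_adjoint U)"
    using d D by (intro psd_congruence psd_mat_diag) auto
  thus ?thesis by (simp flip: D(5))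
qed

text \<open>The quadratic form of \<open>H\<close> at column \<open>i\<close> of \<open>F\<close>.
  Keeping the vectors as columns of one matrix lets changes of basis act by multiplication. For
  Hermitian \<open>H\<close> the entry is already real, so \<open>Re\<close> only fixes the
  type.\<close>

definition quad :: "complex mat \<Rightarrow> complex mat \<Rightarrow> nat \<Rightarrow> real" where
  "quad H F i = Re ((mat_adjoint F * (H * F)) $$ (i, i))"

lemma quad_congruence:
  assumes "H \<in> carrier_mat n n" "G \<in> carrier_mat n n" "F \<in> carrier_mat n n"
  shows "quad (mat_adjoint G * H * G) F i = quad H (G * F) i"
  using assms mat_adjoint_carrier[OF assms(2)] mat_adjoint_carrier[OF assms(3)]
  by (simp add: quad_def mat_adjoint_mult[of _ n n _ n] square_mult[where n=n] square_assoc[where n=n])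

lemma quad_mat_diag:
  assumes "F \<in> carrier_mat n n" "i < n"
  shows "quad (mat_diag n (\<lambda>j. complex_of_real (d j))) F i = (\<Sum>j<n. d j * (cmod (F $$ (j, i)))\<^sup>2)"
proof -
  have "(mat_adjoint F * (mat_diag n (\<lambda>j. complex_of_real (d j)) * F)) $$ (i, i) =
      (\<Sum>j<n. complex_of_real (d j) * (F $$ (j, i) * cnj (F $$ (j, i))))"
    using assms by (simp add: mat_diag_mult_left[OF assms(1)] scalar_prod_def atLeast0LessThan mult_ac)
  also have "\<dots> = complex_of_real (\<Sum>j<n. d j * (cmod (F $$ (j, i)))\<^sup>2)"
    by (simp add: complex_norm_square[symmetric] del: of_real_power)
  finally show ?thesis by (simp add: quad_def)
qed

text \<open>The form is a sum of eigenvalues weighted by the squared coordinates of the column in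
  the eigenbasis. All later inequalities for forms come from scalar inequalities for the
  eigenvalues, summed against these weights.\<close>

lemma quad_spectral:
  assumes U: "spectral_decomposition n H U d" and F: "F \<in> carrier_mat n n" and i: "i < n"
  shows "quad H F i = (\<Sum>j<n. d j * (cmod ((mat_adjoint U * F) $$ (j, i)))\<^sup>2)"
proof -
  note D = spectral_decompositionD[OF U]
  have "quad H F i = quad (mat_adjoint (mat_adjoint U) * mat_diag n (\<lambda>i. complex_of_real (d i)) * mat_adjoint U) F i"
    by (simp flip: D(5))
  also have "\<dots> = quad (mat_diag n (\<lambda>i. complex_of_real (d i))) (mat_adjoint U * F) i"
    using D(2,3) F by (intro quad_congruence) auto
  finally show ?thesis using quad_mat_diag[of "mat_adjoint U * F" n i d] D F i by simp
qed

text \<open>Every unitary diagonalises the identity, so the squared norm of a column is the sum of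
  the same weights that appear in \<open>quad_spectral\<close> for any other matrix.\<close>

lemma spectral_decomposition_one:
  "unitary n U \<Longrightarrow> spectral_decomposition n (1\<^sub>m n) U (\<lambda>_. 1)"
  by (simp add: spectral_decomposition_def unitary_def right_mult_one_mat[of U n n])

lemma quad_nonneg:
  assumes "spectral_decomposition n H U d" "\<And>i. i < n \<Longrightarrow> 0 \<le> d i" "F \<in> carrier_mat n n" "i < n"
  shows "0 \<le> quad H F i"
  using assms by (auto simp: quad_spectral intro!: sum_nonneg)

lemma quad_scale:
  assumes "H \<in> carrier_mat n n" "F \<in> carrier_mat n n" "i < n"
  shows "quad H (F * mat_diag n (\<lambda>j. complex_of_real (s j))) i = (s i)\<^sup>2 * quad H F i"
proof -
  let ?D = "mat_diag n (\<lambda>j. complex_of_real (s j))"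
  note c = assms mat_adjoint_carrier[OF assms(2)]
  have "mat_adjoint (F * ?D) * (H * (F * ?D)) = ?D * (mat_adjoint F * (H * F) * ?D)"
    using c by (simp add: mat_adjoint_mult[of _ n n _ n] square_mult[where n=n] square_assoc[where n=n])
  also have "\<dots> $$ (i, i) = complex_of_real (s i * s i) * (mat_adjoint F * (H * F)) $$ (i, i)"
    using c by (simp add: mat_diag_mult_left[of _ n n] mat_diag_mult_right[of _ n n] del: index_mult_mat(1))
  finally show ?thesis
    by (simp add: quad_def power2_eq_square del: index_mult_mat)
qed

lemma quad_eigenvector:
  assumes U: "spectral_decomposition n H U d" and i: "i < n"
  shows "quad H U i = d i"
proof -
  note D = spectral_decompositionD[OF U]
  have "quad H U i = (\<Sum>j<n. if j = i then d i else 0)"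
    unfolding quad_spectral[OF U D(2) i] unitary_left[OF D(1)] using i by (intro sum.cong) auto
  thus ?thesis using i by simp
qed

text \<open>Each eigenvalue is the value of the form at its eigenvector, hence nonnegative.\<close>

lemma exists_psd_decomposition:
  assumes H: "psd n H"
  obtains U d where "spectral_decomposition n H U d" "\<And>i. i < n \<Longrightarrow> 0 \<le> d i"
    "\<And>i j. i \<le> j \<Longrightarrow> j < n \<Longrightarrow> d j \<le> d i"
proof -
  have c: "H \<in> carrier_mat n n" "mat_adjoint H = H" using H by (auto simp: psd_def)
  obtain U d where U: "spectral_decomposition n H U d" and mono: "\<And>i j. i \<le> j \<Longrightarrow> j < n \<Longrightarrow> d j \<le> d i"
    using hermitian_sorted_decomposition[OF c] by blast
  note D = spectral_decompositionD[OF U]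
  have "0 \<le> d i" if i: "i < n" for i
  proof -
    have eq: "(H *\<^sub>v col U i) \<bullet>c col U i = (mat_adjoint U * (H * U)) $$ (i, i)"
      using i c D(1-3) by (simp add: scalar_prod_def atLeast0LessThan mult.commute)
    hence "quad H U i \<ge> 0" using H i D(2) by (simp add: quad_def psd_def flip: eq)
    thus ?thesis by (simp add: quad_eigenvector[OF U i])
  qed
  with U mono that show thesis by blast
qed

section \<open>Functional calculus on a common eigenbasis\<close>

lemma spectral_decomposition_mat_powr:
  assumes U: "spectral_decomposition n H U d" and d: "\<And>i. i < n \<Longrightarrow> 0 \<le> d i"
  shows "spectral_decomposition n (mat_powr H p) U (\<lambda>i. d i powr p)"
  using mat_powr_eqI[OF U d] spectral_decompositionD(1)[OF U] by (simp add: spectral_decomposition_def)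

lemma spectral_decomposition_mult:
  assumes A: "spectral_decomposition n A U d" and B: "spectral_decomposition n B U e"
  shows "spectral_decomposition n (A * B) U (\<lambda>i. d i * e i)"
proof -
  note DA = spectral_decompositionD[OF A] and DB = spectral_decompositionD[OF B]
  have "A * B = U * (mat_diag n (\<lambda>i. complex_of_real (d i)) * mat_diag n (\<lambda>i. complex_of_real (e i))) * mat_adjoint U"
    unfolding DA(5) DB(5) using DA(2,3) unitary_left[OF DA(1)]
    by (simp add: square_mult[where n=n] square_assoc[where n=n] square_mult_cancel_left[where n=n] del: mat_diag_diag)
  thus ?thesis using DA(1) by (simp add: spectral_decomposition_def)
qed

lemma spectral_decomposition_cong:
  assumes "spectral_decomposition n A U d" "\<And>i. i < n \<Longrightarrow> d i = e i"
  shows "spectral_decomposition n A U e"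
proof -
  have "mat_diag n (\<lambda>i. complex_of_real (d i)) = mat_diag n (\<lambda>i. complex_of_real (e i))"
    using assms(2) by (intro eq_matI) (auto simp: mat_diag_def)
  thus ?thesis using assms(1) by (simp add: spectral_decomposition_def)
qed

text \<open>Identities between powers of one matrix reduce through this to identities between
  eigenvalues on a common eigenbasis.\<close>

lemma spectral_decomposition_unique:
  "spectral_decomposition n A U d \<Longrightarrow> spectral_decomposition n B U d \<Longrightarrow> A = B"
  by (simp add: spectral_decomposition_def)

section \<open>Ky Fan's maximum principle\<close>

text \<open>Let \<open>v\<close> be the sum of the columns of \<open>L\<close>, each weighted by the
  conjugate of its entry in row \<open>j\<close>; for orthonormal columns it is the projection of
  the \<open>j\<close>-th unit vector. Its entry \<open>j\<close> is the sum \<open>q\<close> in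
  question, while its squared norm is at most \<open>q\<close>, so \<open>q * q <= q\<close>.
  Allowing \<open>r i <= 1\<close> admits columns that vanish.\<close>

lemma bessel_inequality:
  fixes L :: "nat \<Rightarrow> nat \<Rightarrow> complex"
  assumes orth: "\<And>i i'. i < k \<Longrightarrow> i' < k \<Longrightarrow>
      (\<Sum>l<n. cnj (L l i) * L l i') = (if i = i' then complex_of_real (r i) else 0)"
    and r: "\<And>i. i < k \<Longrightarrow> r i \<le> 1" and j: "j < n"
  shows "(\<Sum>i<k. (cmod (L j i))\<^sup>2) \<le> 1"
proof -
  define v where "v l = (\<Sum>i<k. L l i * cnj (L j i))" for l
  define q where "q = (\<Sum>i<k. (cmod (L j i))\<^sup>2)"
  have "complex_of_real (\<Sum>l<n. (cmod (v l))\<^sup>2) = (\<Sum>l<n. v l * cnj (v l))"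
    by (simp add: complex_norm_square del: of_real_power)
  also have "\<dots> = (\<Sum>l<n. \<Sum>i<k. \<Sum>i'<k. cnj (L j i) * L j i' * (cnj (L l i') * L l i))"
    unfolding v_def by (simp add: sum_product mult_ac)
  also have "\<dots> = (\<Sum>i<k. \<Sum>l<n. \<Sum>i'<k. cnj (L j i) * L j i' * (cnj (L l i') * L l i))"
    by (rule sum.swap)
  also have "\<dots> = (\<Sum>i<k. \<Sum>i'<k. \<Sum>l<n. cnj (L j i) * L j i' * (cnj (L l i') * L l i))"
    by (rule sum.cong[OF refl], rule sum.swap)
  also have "\<dots> = (\<Sum>i<k. \<Sum>i'<k. if i' = i then cnj (L j i) * L j i * complex_of_real (r i) else 0)"
    unfolding sum_distrib_left[symmetric] by (intro sum.cong refl) (auto simp: orth)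
  also have "\<dots> = (\<Sum>i<k. complex_of_real (r i * (cmod (L j i))\<^sup>2))"
    by (auto intro!: sum.cong simp: complex_norm_square mult_ac simp del: of_real_power)
  also have "\<dots> = complex_of_real (\<Sum>i<k. r i * (cmod (L j i))\<^sup>2)" by simp
  finally have "(\<Sum>l<n. (cmod (v l))\<^sup>2) = (\<Sum>i<k. r i * (cmod (L j i))\<^sup>2)"
    by (simp only: of_real_eq_iff)
  also have "\<dots> \<le> q"
    unfolding q_def using mult_right_mono[OF r, of _ "(cmod (L j _))\<^sup>2"] by (intro sum_mono) simp
  finally have le: "(\<Sum>l<n. (cmod (v l))\<^sup>2) \<le> q" .
  have "v j = complex_of_real q"
    by (simp add: v_def q_def complex_norm_square[symmetric] del: of_real_power)
  moreover have "q \<ge> 0" unfolding q_def by (intro sum_nonneg) auto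
  ultimately have "q\<^sup>2 = (cmod (v j))\<^sup>2" by simp
  also have "\<dots> \<le> (\<Sum>l<n. (cmod (v l))\<^sup>2)"
    using j by (intro member_le_sum) auto
  finally have "q * q \<le> q * 1" using le by (simp add: power2_eq_square)
  hence "q \<le> 1" using \<open>q \<ge> 0\<close> by (cases "q = 0") (auto simp: mult_le_cancel_left)
  thus ?thesis by (simp add: q_def)
qed

lemma decreasing_weighted_sum_le:
  fixes t q :: "nat \<Rightarrow> real"
  assumes t: "\<And>i. i < n \<Longrightarrow> 0 \<le> t i" "\<And>i j. i \<le> j \<Longrightarrow> j < n \<Longrightarrow> t j \<le> t i"
    and q: "\<And>i. i < n \<Longrightarrow> 0 \<le> q i" "\<And>i. i < n \<Longrightarrow> q i \<le> 1"
    and sum: "(\<Sum>i<n. q i) \<le> real k" and k: "k \<le> n"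
  shows "(\<Sum>i<n. t i * q i) \<le> (\<Sum>i<k. t i)"
proof (cases "n = 0")
  case False
  \<comment> \<open>The threshold between the first \<open>k\<close> values and the rest: moving
    weight across it costs at least \<open>s\<close> per unit on one side and gains at most
    \<open>s\<close> on the other. For \<open>k = 0\<close> truncated subtraction gives
    \<open>s = t 0\<close>, which still bounds every \<open>t i\<close>.\<close>
  define s where "s = t (k - 1)"
  have s: "0 \<le> s" using t(1)[of "k - 1"] False k by (simp add: s_def)
  have eq: "(\<Sum>i<k. f i) = (\<Sum>i<n. if i < k then f i else 0)" for f :: "nat \<Rightarrow> real"
    using k by (intro sum.mono_neutral_cong_left) auto
  have "t i * q i - (if i < k then t i else 0) \<le> s * q i - s * (if i < k then 1 else 0)" if i: "i < n" for i
  proof (cases "i < k")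
    case True
    hence "(t i - s) * q i \<le> (t i - s) * 1"
      unfolding s_def using t(2)[of i "k - 1"] k q[OF i] by (intro mult_left_mono) auto
    thus ?thesis using True by (simp add: algebra_simps)
  next
    case False
    hence "t i * q i \<le> s * q i"
      unfolding s_def using t(2)[of "k - 1" i] i q[OF i] by (intro mult_right_mono) auto
    thus ?thesis using False by simp
  qed
  hence "(\<Sum>i<n. t i * q i - (if i < k then t i else 0)) \<le> (\<Sum>i<n. s * q i - s * (if i < k then 1 else 0))"
    by (intro sum_mono) auto
  also have "\<dots> = s * ((\<Sum>i<n. q i) - (\<Sum>i<n. if i < k then 1 else 0))"
    by (simp add: sum_subtractf sum_distrib_left right_diff_distrib del: sum.If_cases)
  also have "(\<Sum>i<n. if i < k then 1 else 0) = real k"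
    using eq[of "\<lambda>_. 1"] by simp
  also have "s * ((\<Sum>i<n. q i) - real k) \<le> 0"
    using s sum by (intro mult_nonneg_nonpos) auto
  finally show ?thesis by (simp add: sum_subtractf eq[of t])
qed (use k in simp)

lemma ky_fan_sum_le:
  assumes T: "spectral_decomposition n T P t"
    and t: "\<And>i. i < n \<Longrightarrow> 0 \<le> t i" "\<And>i j. i \<le> j \<Longrightarrow> j < n \<Longrightarrow> t j \<le> t i"
    and K: "K \<in> carrier_mat n n" and k: "k \<le> n"
    and orth: "\<And>i j. i < k \<Longrightarrow> j < k \<Longrightarrow>
      (mat_adjoint K * K) $$ (i, j) = (if i = j then complex_of_real (r i) else 0)"
    and r: "\<And>i. i < k \<Longrightarrow> r i \<le> 1"
  shows "(\<Sum>i<k. quad T K i) \<le> (\<Sum>i<k. t i)"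
proof -
  note D = spectral_decompositionD[OF T]
  define L where "L = mat_adjoint P * K"
  have L: "L \<in> carrier_mat n n" using D K by (simp add: L_def)
  have LL: "mat_adjoint L * L = mat_adjoint K * K"
    using D(2,3) K mat_adjoint_carrier[OF K] unitary_right[OF D(1)]
    by (simp add: L_def mat_adjoint_mult[of _ n n _ n] square_mult[where n=n] square_assoc[where n=n]
      square_mult_cancel_left[where n=n])
  have orthL: "(\<Sum>l<n. cnj (L $$ (l, i)) * L $$ (l, j)) = (if i = j then complex_of_real (r i) else 0)"
    if "i < k" "j < k" for i j
    using orth[OF that] that k L by (simp add: scalar_prod_def atLeast0LessThan flip: LL)
  define q where "q j = (\<Sum>i<k. (cmod (L $$ (j, i)))\<^sup>2)" for j
  have q: "0 \<le> q j" for j unfolding q_def by (intro sum_nonneg) auto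
  have q1: "q j \<le> 1" if "j < n" for j
    unfolding q_def by (rule bessel_inequality[where n=n and r=r]) (use orthL r that in auto)
  have "complex_of_real (\<Sum>l<n. (cmod (L $$ (l, i)))\<^sup>2) = complex_of_real (r i)" if "i < k" for i
    using orthL[OF that that] by (simp add: complex_norm_square mult.commute del: of_real_power)
  hence col: "(\<Sum>l<n. (cmod (L $$ (l, i)))\<^sup>2) = r i" if "i < k" for i
    using that by (simp only: of_real_eq_iff)
  have "(\<Sum>j<n. q j) = (\<Sum>i<k. \<Sum>j<n. (cmod (L $$ (j, i)))\<^sup>2)"
    unfolding q_def by (rule sum.swap)
  also have "\<dots> \<le> (\<Sum>i<k. 1)" using col r by (intro sum_mono) auto
  finally have "(\<Sum>j<n. t j * q j) \<le> (\<Sum>j<k. t j)"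
    by (intro decreasing_weighted_sum_le) (use t q q1 k in auto)
  also have "(\<Sum>j<n. t j * q j) = (\<Sum>i<k. \<Sum>j<n. t j * (cmod (L $$ (j, i)))\<^sup>2)"
    unfolding q_def sum_distrib_left by (rule sum.swap)
  also have "\<dots> = (\<Sum>i<k. quad T K i)"
    using quad_spectral[OF T K] k by (intro sum.cong) (auto simp: L_def)
  finally show ?thesis .
qed

section \<open>Jensen and Young inequalities\<close>

text \<open>The tangent of a convex power lies below it; this is Young's inequality with exponents
  \<open>p\<close> and \<open>p / (p - 1)\<close>, rearranged.\<close>

lemma powr_tangent_le:
  fixes y t p :: real
  assumes "y \<ge> 0" "t \<ge> 0" "p > 1"
  shows "t powr p + p * t powr (p - 1) * (y - t) \<le> y powr p"
proof -
  have "y * t powr (p - 1) \<le> y powr p / p + (t powr (p - 1)) powr (p / (p - 1)) / (p / (p - 1))"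
    using assms by (intro Youngs_inequality) (auto simp: field_simps)
  also have "(t powr (p - 1)) powr (p / (p - 1)) = t powr p"
    using assms by (simp add: powr_powr)
  finally have "p * (y * t powr (p - 1)) \<le> y powr p + (p - 1) * t powr p"
    using assms by (simp add: field_simps)
  moreover have "t powr (p - 1) * t = t powr p"
    using assms powr_mult_base[of t "p - 1"] by (simp add: mult.commute)
  ultimately show ?thesis by (simp add: algebra_simps)
qed

lemma young_scaled:
  fixes \<alpha> m y p :: real
  assumes "\<alpha> \<ge> 0" "m \<ge> 0" "y \<ge> 0" "p > 1"
  shows "\<alpha> * m * y \<le> y powr p + (p - 1) * (\<alpha> / p) powr (p / (p - 1)) * m powr (p / (p - 1))"
proof -
  \<comment> \<open>The point at which the tangent of the \<open>p\<close>-th power has slope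
    \<open>\<alpha> * m\<close>.\<close>
  define t where "t = (\<alpha> * m / p) powr (1 / (p - 1))"
  have t: "t \<ge> 0" by (simp add: t_def)
  have t1: "p * t powr (p - 1) = \<alpha> * m" using assms by (simp add: t_def powr_powr)
  have tp: "t powr p = (\<alpha> / p) powr (p / (p - 1)) * m powr (p / (p - 1))"
    using assms by (simp add: t_def powr_powr flip: powr_mult)
  have "p * (t powr (p - 1) * t) = p * t powr p"
    using t assms powr_mult_base[of t "p - 1"] by (simp add: mult.commute)
  hence "\<alpha> * m * t = p * t powr p" by (simp flip: t1)
  with powr_tangent_le[OF assms(3) t assms(4)]
  have "\<alpha> * m * y \<le> y powr p + (p - 1) * t powr p"
    unfolding t1 by (simp add: algebra_simps)
  thus ?thesis unfolding tp by (simp add: mult.assoc)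
qed

text \<open>Jensen's inequality for the spectral weights, which sum to \<open>1\<close> at a unit
  column: summing the tangent bounds at the mean \<open>m\<close> makes the linear terms
  cancel.\<close>

lemma quad_powr_le:
  assumes T: "spectral_decomposition n T P t" "\<And>i. i < n \<Longrightarrow> 0 \<le> t i"
    and F: "F \<in> carrier_mat n n" "i < n" and unit: "quad (1\<^sub>m n) F i = 1" and q: "q > 1"
  shows "(quad T F i) powr q \<le> quad (mat_powr T q) F i"
proof -
  define w where "w j = (cmod ((mat_adjoint P * F) $$ (j, i)))\<^sup>2" for j
  define m where "m = quad T F i"
  have m: "m = (\<Sum>j<n. t j * w j)"
    by (simp add: m_def w_def quad_spectral[OF T(1) F])
  have w1: "(\<Sum>j<n. w j) = 1"
    using unit quad_spectral[OF spectral_decomposition_one[OF spectral_decompositionD(1)[OF T(1)]] F]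
    by (simp add: w_def)
  have m0: "m \<ge> 0" unfolding m_def by (rule quad_nonneg[OF T F])
  have "(\<Sum>j<n. (m powr q + q * m powr (q - 1) * (t j - m)) * w j) =
      m powr q * (\<Sum>j<n. w j) + q * m powr (q - 1) * ((\<Sum>j<n. t j * w j) - m * (\<Sum>j<n. w j))"
    by (simp add: algebra_simps sum.distrib sum_subtractf sum_distrib_left)
  hence "m powr q = (\<Sum>j<n. (m powr q + q * m powr (q - 1) * (t j - m)) * w j)"
    by (simp add: w1 flip: m)
  also have "\<dots> \<le> (\<Sum>j<n. t j powr q * w j)"
    using powr_tangent_le[OF T(2) m0 q] by (intro sum_mono mult_right_mono) (auto simp: w_def)
  also have "\<dots> = quad (mat_powr T q) F i"
    using quad_spectral[OF spectral_decomposition_mat_powr[OF T] F] by (simp add: w_def)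
  finally show ?thesis by (simp add: m_def)
qed

section \<open>Diagonalising a compression\<close>

text \<open>Rotating only the first \<open>k\<close> basis vectors by \<open>Q\<close> conjugates
  the leading block by \<open>Q\<close>, so it can be diagonalised as a matrix of size
  \<open>k\<close>.\<close>

lemma index_block_diag_compression:
  assumes T: "T \<in> carrier_mat (k + l) (k + l)" and Q: "Q \<in> carrier_mat k k" and ij: "i < k" "j < k"
  shows "(mat_adjoint (block_diag k l Q (1\<^sub>m l)) * (T * block_diag k l Q (1\<^sub>m l))) $$ (i, j) =
    (mat_adjoint Q * (mat k k (\<lambda>ij. T $$ ij) * Q)) $$ (i, j)"
proof -
  obtain T1 T2 T3 T4 where split: "split_block T k k = (T1, T2, T3, T4)"
    by (cases "split_block T k k") auto
  hence T': "T1 \<in> carrier_mat k k" "T2 \<in> carrier_mat k l" "T3 \<in> carrier_mat l k" "T4 \<in> carrier_mat l l"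
    "T = four_block_mat T1 T2 T3 T4"
    using split_block[OF split, of l l] T by auto
  have T1: "mat k k (\<lambda>ij. T $$ ij) = T1"
    using T' by (intro eq_matI) auto
  note c = T'(1-4) Q mat_adjoint_carrier[OF Q]
  have "T * block_diag k l Q (1\<^sub>m l) = four_block_mat (T1 * Q) T2 (T3 * Q) T4"
    unfolding T'(5) using c by (subst mult_four_block_mat[of _ k k _ l _ l _ _ k _ l]) auto
  hence "mat_adjoint (block_diag k l Q (1\<^sub>m l)) * (T * block_diag k l Q (1\<^sub>m l)) =
      block_diag k l (mat_adjoint Q) (1\<^sub>m l) * four_block_mat (T1 * Q) T2 (T3 * Q) T4"
    using Q by (simp add: mat_adjoint_block_diag)
  also have "\<dots> = four_block_mat (mat_adjoint Q * (T1 * Q)) (mat_adjoint Q * T2) (T3 * Q) T4"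
    using c by (subst mult_four_block_mat[of _ k k _ l _ l _ _ k _ l]) auto
  also have "\<dots> $$ (i, j) = (mat_adjoint Q * (T1 * Q)) $$ (i, j)"
    using c ij by simp
  finally show ?thesis unfolding T1 .
qed

lemma trace_unitary_conjugate:
  assumes T: "T \<in> carrier_mat k k" and Q: "unitary k Q"
  shows "(\<Sum>i<k. (mat_adjoint Q * (T * Q)) $$ (i, i)) = (\<Sum>i<k. T $$ (i, i))"
proof -
  note Qc = unitary_carrier[OF Q]
  have "(\<Sum>i<k. (mat_adjoint Q * (T * Q)) $$ (i, i)) =
      (\<Sum>i<k. \<Sum>a<k. \<Sum>b<k. T $$ (a, b) * (Q $$ (b, i) * cnj (Q $$ (a, i))))"
    using T Qc by (simp add: scalar_prod_def atLeast0LessThan sum_distrib_left mult_ac)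
  also have "\<dots> = (\<Sum>a<k. \<Sum>i<k. \<Sum>b<k. T $$ (a, b) * (Q $$ (b, i) * cnj (Q $$ (a, i))))"
    by (rule sum.swap)
  also have "\<dots> = (\<Sum>a<k. \<Sum>b<k. \<Sum>i<k. T $$ (a, b) * (Q $$ (b, i) * cnj (Q $$ (a, i))))"
    by (rule sum.cong[OF refl], rule sum.swap)
  also have "\<dots> = (\<Sum>a<k. \<Sum>b<k. T $$ (a, b) * (Q * mat_adjoint Q) $$ (b, a))"
    using Qc by (simp add: scalar_prod_def atLeast0LessThan sum_distrib_left)
  also have "\<dots> = (\<Sum>a<k. \<Sum>b<k. if b = a then T $$ (a, a) else 0)"
    unfolding unitary_right[OF Q] by (intro sum.cong refl) auto
  finally show ?thesis by simp
qed

text \<open>Diagonalise the leading block of \<open>M\<close> in the basis \<open>W\<close> and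
  rotate the first \<open>k\<close> columns of \<open>W\<close> accordingly. Their span is
  unchanged, and the sum of the forms is the trace of the compression to it, which depends on the
  span alone.\<close>

lemma exists_compression_diagonalizer:
  assumes W: "unitary n W" and M: "M \<in> carrier_mat n n" "mat_adjoint M = M" and k: "k \<le> n"
  obtains F where "unitary n F"
    "\<And>i j. i < k \<Longrightarrow> j < k \<Longrightarrow> i \<noteq> j \<Longrightarrow> (mat_adjoint F * (M * F)) $$ (i, j) = 0"
    "\<And>T. T \<in> carrier_mat n n \<Longrightarrow> (\<Sum>i<k. quad T F i) = (\<Sum>i<k. quad T W i)"
proof -
  define l where "l = n - k"
  have n: "n = k + l" using k by (simp add: l_def)
  note Wc = unitary_carrier[OF W] unitary_carrier_adjoint[OF W]
  define C where "C T = mat_adjoint W * (T * W)" for T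
  have C: "C T \<in> carrier_mat n n" if "T \<in> carrier_mat n n" for T
    using that Wc by (simp add: C_def)
  define M' where "M' = mat k k (\<lambda>ij. C M $$ ij)"
  have CM: "mat_adjoint (C M) = C M"
    using Wc M by (simp add: C_def mat_adjoint_mult[of _ n n _ n] square_mult[where n=n] square_assoc[where n=n])
  have "cnj (C M $$ (j, i)) = C M $$ (i, j)" if "i < n" "j < n" for i j
    using arg_cong[OF CM, of "\<lambda>A. A $$ (i, j)"] that C[OF M(1)] by simp
  hence "mat_adjoint M' = M'" using k by (intro eq_matI) (auto simp: M'_def)
  moreover have "M' \<in> carrier_mat k k" by (simp add: M'_def)
  ultimately obtain Q m where Q: "spectral_decomposition k M' Q m"
    using hermitian_spectral_decomposition by blast
  note D = spectral_decompositionD[OF Q]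
  define B where "B = block_diag k l Q (1\<^sub>m l)"
  have B: "unitary n B" unfolding B_def n by (intro unitary_block_diag D unitary_one)
  note Bc = unitary_carrier[OF B] unitary_carrier_adjoint[OF B]
  have F: "mat_adjoint (W * B) * (T * (W * B)) = mat_adjoint B * (C T * B)" if "T \<in> carrier_mat n n" for T
    using Wc Bc that by (simp add: C_def mat_adjoint_mult[of _ n n _ n] square_mult[where n=n] square_assoc[where n=n])
  have idx: "(mat_adjoint (W * B) * (T * (W * B))) $$ (i, j) = (mat_adjoint Q * (mat k k (\<lambda>ij. C T $$ ij) * Q)) $$ (i, j)"
    if "T \<in> carrier_mat n n" "i < k" "j < k" for T i j
    unfolding F[OF that(1)] unfolding B_def using C[OF that(1)] that D(2) unfolding n
    by (intro index_block_diag_compression) auto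
  show thesis
  proof (rule that)
    show "unitary n (W * B)" by (rule unitary_mult[OF W B])
    have "mat_adjoint Q * (M' * Q) = mat_diag k (\<lambda>i. complex_of_real (m i))"
      unfolding D(5) using D(2,3) unitary_left[OF D(1)]
      by (simp add: square_mult[where n=k] square_assoc[where n=k] square_mult_cancel_left[where n=k]
        right_mult_one_mat[of _ k k])
    thus "(mat_adjoint (W * B) * (M * (W * B))) $$ (i, j) = 0" if "i < k" "j < k" "i \<noteq> j" for i j
      using idx[OF M(1) that(1,2)] that by (simp add: M'_def mat_diag_def)
    fix T :: "complex mat" assume T: "T \<in> carrier_mat n n"
    have "(\<Sum>i<k. (mat_adjoint (W * B) * (T * (W * B))) $$ (i, i)) =
        (\<Sum>i<k. (mat_adjoint Q * (mat k k (\<lambda>ij. C T $$ ij) * Q)) $$ (i, i))"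
      using idx[OF T] by (intro sum.cong) auto
    also have "\<dots> = (\<Sum>i<k. mat k k (\<lambda>ij. C T $$ ij) $$ (i, i))"
      by (rule trace_unitary_conjugate[OF _ D(1)]) auto
    also have "\<dots> = (\<Sum>i<k. C T $$ (i, i))" by simp
    finally show "(\<Sum>i<k. quad T (W * B) i) = (\<Sum>i<k. quad T W i)"
      unfolding quad_def Re_sum[symmetric] C_def by simp
  qed
qed

section \<open>Ky Fan's dominance principle\<close>

lemma symmetric_norm_spectral:
  assumes N: "symmetric_norm n N" and U: "spectral_decomposition n H U d"
  shows "N H = N (mat_diag n (\<lambda>i. complex_of_real (d i)))"
  using assms spectral_decompositionD[OF U] unitary_adjoint
  unfolding symmetric_norm_def by (metis mat_diag_dim)

lemma symmetric_norm_diag_permute: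
  assumes N: "symmetric_norm n N" and \<sigma>: "bij_betw \<sigma> {..<n} {..<n}"
  shows "N (mat_diag n (\<lambda>i. complex_of_real (d (\<sigma> i)))) = N (mat_diag n (\<lambda>i. complex_of_real (d i)))"
proof -
  have "spectral_decomposition n (mat_diag n (\<lambda>i. complex_of_real (d i))) (1\<^sub>m n) d"
    by (simp add: spectral_decomposition_def left_mult_one_mat[of _ n n] right_mult_one_mat[of _ n n])
  from symmetric_norm_spectral[OF N spectral_decomposition_permute[OF this \<sigma>]] show ?thesis by simp
qed

lemma symmetric_norm_diag_linear_le:
  assumes N: "symmetric_norm n N" and "0 \<le> s" "0 \<le> t"
  shows "N (mat_diag n (\<lambda>i. complex_of_real (s * x i + t * y i))) \<le>
    s * N (mat_diag n (\<lambda>i. complex_of_real (x i))) + t * N (mat_diag n (\<lambda>i. complex_of_real (y i)))"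
proof -
  let ?D = "\<lambda>f. mat_diag n (\<lambda>i. complex_of_real (f i))"
  have "?D (\<lambda>i. s * x i + t * y i) = complex_of_real s \<cdot>\<^sub>m ?D x + complex_of_real t \<cdot>\<^sub>m ?D y"
    by (intro eq_matI) (auto simp: mat_diag_def)
  also have "N \<dots> \<le> N (complex_of_real s \<cdot>\<^sub>m ?D x) + N (complex_of_real t \<cdot>\<^sub>m ?D y)"
    using N unfolding symmetric_norm_def by (metis mat_diag_dim smult_carrier_mat)
  also have "\<dots> = s * N (?D x) + t * N (?D y)"
    using N assms(2,3) by (simp add: symmetric_norm_def)
  finally show ?thesis .
qed

text \<open>The entries are lowered one at a time. Changing the sign of one entry is multiplication
  by a unitary, and \<open>x k\<close> is a convex combination of \<open>y k\<close> and
  \<open>- y k\<close>.\<close>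

lemma symmetric_norm_diag_mono:
  assumes N: "symmetric_norm n N" and "\<And>i. i < n \<Longrightarrow> 0 \<le> x i" "\<And>i. i < n \<Longrightarrow> x i \<le> y i"
  shows "N (mat_diag n (\<lambda>i. complex_of_real (x i))) \<le> N (mat_diag n (\<lambda>i. complex_of_real (y i)))"
proof -
  let ?D = "\<lambda>f. mat_diag n (\<lambda>i. complex_of_real (f i))"
  have "N (?D (\<lambda>i. if i < k then x i else y i)) \<le> N (?D y)" if "k \<le> n" for k
    using that
  proof (induction k)
    case (Suc k)
    let ?f = "\<lambda>i. if i < k then x i else y i"
    let ?g = "\<lambda>i. if i = k then - y k else ?f i"
    have k: "k < n" using Suc.prems by simp
    define S where "S = mat_diag n (\<lambda>i. if i = k then - 1 else 1 :: complex)"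
    have S: "unitary n S"
      by (rule unitaryI) (auto simp: S_def if_distrib[of "\<lambda>x. x * _"] if_distrib[of cnj] cong: if_cong)
    have "S * ?D ?f * 1\<^sub>m n = mat_diag n (\<lambda>i. (if i = k then - 1 else 1) * complex_of_real (?f i))"
      by (simp add: S_def right_mult_one_mat[of _ n n])
    also have "\<dots> = ?D ?g"
      by (intro eq_matI) (auto simp: mat_diag_def)
    finally have "S * ?D ?f * 1\<^sub>m n = ?D ?g" .
    hence g: "N (?D ?g) = N (?D ?f)"
      using N S unitary_one[of n] unfolding symmetric_norm_def by (metis mat_diag_dim)
    obtain s where s: "0 \<le> s" "s \<le> 1" "x k = s * y k + (1 - s) * (- y k)"
    proof (cases "y k = 0")
      case True
      thus thesis using assms(2,3)[OF k] by (intro that[of 0]) auto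
    next
      case False
      \<comment> \<open>The witness solves \<open>x k = s * y k - (1 - s) * y k\<close> for
        \<open>s\<close>.\<close>
      thus thesis using assms(2,3)[OF k] by (intro that[of "(x k / y k + 1) / 2"]) (auto simp: field_simps)
    qed
    have eq: "(if i < Suc k then x i else y i) = s * ?f i + (1 - s) * ?g i" for i
      using s(3) by (auto simp: less_Suc_eq algebra_simps)
    have "N (?D (\<lambda>i. if i < Suc k then x i else y i)) \<le> s * N (?D ?f) + (1 - s) * N (?D ?g)"
      unfolding eq by (rule symmetric_norm_diag_linear_le[OF N]) (use s in auto)
    also have "\<dots> = N (?D ?f)" unfolding g by (simp add: algebra_simps)
    also have "\<dots> \<le> N (?D y)" using Suc.IH k by simp
    finally show ?case .
  qed simp
  from this[of n] have "N (?D (\<lambda>i. if i < n then x i else y i)) \<le> N (?D y)" by simp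
  also have "?D (\<lambda>i. if i < n then x i else y i) = ?D x"
    by (intro eq_matI) (auto simp: mat_diag_def)
  finally show ?thesis .
qed

text \<open>Moving mass from a larger entry to a smaller one, by at most their difference, is a
  convex combination of \<open>y\<close> and \<open>y\<close> with the two entries swapped.\<close>

lemma symmetric_norm_diag_transfer:
  assumes N: "symmetric_norm n N" and ij: "i < n" "j < n" "i \<noteq> j"
    and \<delta>: "0 \<le> \<delta>" "\<delta> \<le> y i - y j"
  shows "N (mat_diag n (\<lambda>l. complex_of_real ((y(i := y i - \<delta>, j := y j + \<delta>)) l)))
    \<le> N (mat_diag n (\<lambda>l. complex_of_real (y l)))"
proof -
  let ?D = "\<lambda>f. mat_diag n (\<lambda>i. complex_of_real (f i))"
  let ?\<tau> = "Transposition.transpose i j"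
  have "bij_betw ?\<tau> {..<n} {..<n}"
    using ij by (intro bij_betw_byWitness[where f' = ?\<tau>]) (auto simp: Transposition.transpose_def)
  hence swap: "N (?D (\<lambda>l. y (?\<tau> l))) = N (?D y)"
    by (rule symmetric_norm_diag_permute[OF N])
  \<comment> \<open>If the two entries agree, then \<open>\<delta> = 0\<close> and nothing
    moves.\<close>
  define s where "s = (if y i = y j then 0 else \<delta> / (y i - y j))"
  have s: "0 \<le> s" "s \<le> 1" "s * (y i - y j) = \<delta>" using \<delta> by (auto simp: s_def)
  have "y(i := y i - \<delta>, j := y j + \<delta>) = (\<lambda>l. (1 - s) * y l + s * y (?\<tau> l))"
    using ij(3) by (auto simp: fun_eq_iff Transposition.transpose_def algebra_simps simp flip: s(3))
  hence "N (?D (y(i := y i - \<delta>, j := y j + \<delta>))) \<le> (1 - s) * N (?D y) + s * N (?D (\<lambda>l. y (?\<tau> l)))"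
    using symmetric_norm_diag_linear_le[OF N, of "1 - s" s y "\<lambda>l. y (?\<tau> l)"] s(1,2) by simp
  also have "\<dots> = N (?D y)" unfolding swap by (simp add: algebra_simps)
  finally show ?thesis .
qed

text \<open>Induction on the number of indices where \<open>x\<close> and \<open>y\<close> differ.
  If \<open>x\<close> lies below \<open>y\<close> pointwise, monotonicity finishes. Otherwise a
  transfer inside \<open>y\<close>, which does not increase the norm, creates a new agreement and
  preserves the partial sum inequalities.\<close>

theorem ky_fan_dominance:
  assumes N: "symmetric_norm n N"
    and x: "\<And>i. i < n \<Longrightarrow> 0 \<le> x i" "\<And>i j. i \<le> j \<Longrightarrow> j < n \<Longrightarrow> x j \<le> x i"
    and sums: "\<And>k. k \<le> n \<Longrightarrow> (\<Sum>i<k. x i) \<le> (\<Sum>i<k. y i)"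
  shows "N (mat_diag n (\<lambda>i. complex_of_real (x i))) \<le> N (mat_diag n (\<lambda>i. complex_of_real (y i)))"
  using sums
proof (induction "card {i. i < n \<and> x i \<noteq> y i}" arbitrary: y rule: less_induct)
  case less
  let ?D = "\<lambda>f. mat_diag n (\<lambda>i. complex_of_real (f i))"
  show ?case
  proof (cases "\<forall>i<n. x i \<le> y i")
    case True
    thus ?thesis by (intro symmetric_norm_diag_mono[OF N]) (use x in auto)
  next
    case False
    define j where "j = (LEAST j. j < n \<and> y j < x j)"
    have j: "j < n" "y j < x j"
      using LeastI_ex[of "\<lambda>j. j < n \<and> y j < x j"] False unfolding j_def by (auto simp: not_le)
    have before: "x l \<le> y l" if "l < j" for l
      using not_less_Least[of l "\<lambda>j. j < n \<and> y j < x j"] that j unfolding j_def[symmetric] by auto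
    \<comment> \<open>Otherwise \<open>y\<close> agrees with \<open>x\<close> before
      \<open>j\<close> and falls short at \<open>j\<close>, against the partial sum of length
      \<open>Suc j\<close>.\<close>
    have "\<exists>l<j. x l < y l"
    proof (rule ccontr)
      assume "\<not> ?thesis"
      hence "y l = x l" if "l < j" for l using that before[OF that] by force
      hence "(\<Sum>l<j. y l) = (\<Sum>l<j. x l)" by (intro sum.cong) auto
      thus False using less.prems[of "Suc j"] j by simp
    qed
    \<comment> \<open>Moving mass from $i$ to $j$ keeps all partial sums above those of $x$, since $x$ and $y$
      agree strictly between them, and makes $y$ agree with $x$ at $i$ or at $j$.\<close>
    define i where "i = (GREATEST l. l < j \<and> x l < y l)"
    have i: "i < j" "x i < y i"
      using GreatestI_ex_nat[of "\<lambda>l. l < j \<and> x l < y l" j] \<open>\<exists>l<j. x l < y l\<close> unfolding i_def by auto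
    have between: "x l = y l" if "i < l" "l < j" for l
    proof -
      have "\<not> x l < y l"
        using Greatest_le_nat[of "\<lambda>l. l < j \<and> x l < y l" l j] that unfolding i_def[symmetric] by auto
      thus ?thesis using before[OF that(2)] by simp
    qed
    define \<delta> where "\<delta> = min (y i - x i) (x j - y j)"
    have \<delta>: "0 < \<delta>" "\<delta> \<le> y i - x i" "\<delta> \<le> x j - y j" using i j by (auto simp: \<delta>_def)
    \<comment> \<open>With this, \<open>y i - y j\<close> is at least
      \<open>(y i - x i) + (x j - y j)\<close>, hence at least \<open>\<delta>\<close>, as the
      transfer requires.\<close>
    have xij: "x j \<le> x i" using x(2)[of i j] i j by simp
    define z where "z = y(i := y i - \<delta>, j := y j + \<delta>)"
    have "{l. l < n \<and> x l \<noteq> z l} \<subset> {l. l < n \<and> x l \<noteq> y l}"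
    proof (rule psubsetI)
      show "{l. l < n \<and> x l \<noteq> z l} \<subseteq> {l. l < n \<and> x l \<noteq> y l}"
        using i j by (auto simp: z_def)
      have "x i = z i \<or> x j = z j" using i by (auto simp: z_def \<delta>_def min_def)
      moreover have "i \<in> {l. l < n \<and> x l \<noteq> y l}" "j \<in> {l. l < n \<and> x l \<noteq> y l}"
        using i j by auto
      ultimately show "{l. l < n \<and> x l \<noteq> z l} \<noteq> {l. l < n \<and> x l \<noteq> y l}"
        by blast
    qed
    hence card: "card {l. l < n \<and> x l \<noteq> z l} < card {l. l < n \<and> x l \<noteq> y l}"
      by (intro psubset_card_mono) auto
    have "(\<Sum>l<k. x l) \<le> (\<Sum>l<k. z l)" if k: "k \<le> n" for k
    proof -
      have sum_z: "(\<Sum>l<k. z l) = (\<Sum>l<k. y l) - (if i < k then \<delta> else 0) + (if j < k then \<delta> else 0)"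
      proof -
        have "(\<Sum>l<k. z l) = (\<Sum>l<k. y l - (if l = i then \<delta> else 0) + (if l = j then \<delta> else 0))"
          using i by (intro sum.cong) (auto simp: z_def)
        thus ?thesis by (simp add: sum.distrib sum_subtractf)
      qed
      show ?thesis
      proof (cases "i < k \<and> k \<le> j")
        case True
        have "(\<Sum>l<k. if l = i then y i - x i else 0) \<le> (\<Sum>l<k. y l - x l)"
          using before i True by (intro sum_mono) auto
        hence "y i - x i \<le> (\<Sum>l<k. y l) - (\<Sum>l<k. x l)"
          using True by (simp add: sum_subtractf)
        thus ?thesis using sum_z True \<delta> by simp
      next
        case False
        thus ?thesis using less.prems[OF k] sum_z i by auto
      qed
    qed
    from less.hyps[OF card this] have "N (?D x) \<le> N (?D z)" by simp
    also have "\<dots> \<le> N (?D y)"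
      unfolding z_def using i j \<delta> xij by (intro symmetric_norm_diag_transfer[OF N]) auto
    finally show ?thesis .
  qed
qed

section \<open>Weak majorization of the eigenvalues\<close>

lemma quad_complex:
  assumes H: "H \<in> carrier_mat n n" "mat_adjoint H = H" and F: "F \<in> carrier_mat n n" and i: "i < n"
  shows "(mat_adjoint F * (H * F)) $$ (i, i) = complex_of_real (quad H F i)"
proof -
  have "mat_adjoint (mat_adjoint F * (H * F)) = mat_adjoint F * (H * F)"
    using H F mat_adjoint_carrier[OF F]
    by (simp add: mat_adjoint_mult[of _ n n _ n] square_mult[where n=n] square_assoc[where n=n])
  from arg_cong[OF this, of "\<lambda>A. A $$ (i, i)"]
  have "cnj ((mat_adjoint F * (H * F)) $$ (i, i)) = (mat_adjoint F * (H * F)) $$ (i, i)"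
    using F i by (simp del: index_mult_mat(1))
  thus ?thesis by (simp add: quad_def complex_eq_iff del: index_mult_mat)
qed

lemma quad_one_eq_0:
  assumes T: "spectral_decomposition n T P t" and F: "F \<in> carrier_mat n n" "i < n" and 0: "quad (1\<^sub>m n) F i = 0"
  shows "quad T F i = 0"
proof -
  have "(\<Sum>j<n. (cmod ((mat_adjoint P * F) $$ (j, i)))\<^sup>2) = 0"
    using 0 quad_spectral[OF spectral_decomposition_one[OF spectral_decompositionD(1)[OF T]] F] by simp
  hence "cmod ((mat_adjoint P * F) $$ (j, i)) = 0" if "j < n" for j
    using that by (subst (asm) sum_nonneg_eq_0_iff) auto
  thus ?thesis unfolding quad_spectral[OF T F] by (intro sum.neutral) simp
qed

lemma quad_powr_le_linear:
  assumes Z: "spectral_decomposition n Z V z" "\<And>i. i < n \<Longrightarrow> 0 \<le> z i"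
    and chord: "\<And>i. i < n \<Longrightarrow> z i powr p \<le> \<alpha> * z i + \<beta>"
    and F: "F \<in> carrier_mat n n" "i < n"
  shows "quad (mat_powr Z p) F i \<le> \<alpha> * quad Z F i + \<beta> * quad (1\<^sub>m n) F i"
proof -
  define w where "w j = (cmod ((mat_adjoint V * F) $$ (j, i)))\<^sup>2" for j
  have "quad (mat_powr Z p) F i = (\<Sum>j<n. z j powr p * w j)"
    using quad_spectral[OF spectral_decomposition_mat_powr[OF Z] F] by (simp add: w_def)
  also have "\<dots> \<le> (\<Sum>j<n. (\<alpha> * z j + \<beta>) * w j)"
    using chord by (intro sum_mono mult_right_mono) (auto simp: w_def)
  also have "\<dots> = \<alpha> * (\<Sum>j<n. z j * w j) + \<beta> * (\<Sum>j<n. w j)"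
    by (simp add: sum_distrib_left sum.distrib algebra_simps)
  also have "\<dots> = \<alpha> * quad Z F i + \<beta> * quad (1\<^sub>m n) F i"
    using quad_spectral[OF Z(1) F]
      quad_spectral[OF spectral_decomposition_one[OF spectral_decompositionD(1)[OF Z(1)]] F]
    by (simp add: w_def)
  finally show ?thesis .
qed

lemma eigenvalue_partial_sums_le:
  assumes A: "spectral_decomposition n A U d" "\<And>i. i < n \<Longrightarrow> 0 \<le> d i" "\<And>i j. i \<le> j \<Longrightarrow> j < n \<Longrightarrow> d j \<le> d i"
    and Z: "spectral_decomposition n Z V z" "\<And>i. i < n \<Longrightarrow> 0 \<le> z i"
    and Y: "spectral_decomposition n (A * Z * A) P y" "\<And>i. i < n \<Longrightarrow> 0 \<le> y i" "\<And>i j. i \<le> j \<Longrightarrow> j < n \<Longrightarrow> y j \<le> y i"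
    and X: "spectral_decomposition n (mat_powr A p * mat_powr Z p * mat_powr A p) Q x"
    and p: "p > 1" and \<alpha>: "\<alpha> \<ge> 0"
    and chord: "\<And>i. i < n \<Longrightarrow> z i powr p \<le> \<alpha> * z i + \<beta>"
    and C: "C = (p - 1) * (\<alpha> / p) powr (p / (p - 1)) + \<beta>" "C \<ge> 0"
    and k: "k \<le> n"
  shows "(\<Sum>i<k. x i) \<le> (\<Sum>i<k. y i powr p + C * d i powr (2 * p))"
proof -
  define q where "q = p / (p - 1)"
  have q: "q > 1" using p by (simp add: q_def)
  define c where "c = (p - 1) * (\<alpha> / p) powr q"
  have Cc: "C = c + \<beta>" by (simp add: C(1) c_def q_def)
  define S where "S = mat_powr A (p - 1)"
  define B where "B = mat_powr A p"
  define B2 where "B2 = mat_powr A (2 * p)"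
  have sS: "spectral_decomposition n S U (\<lambda>i. d i powr (p - 1))"
    and sB: "spectral_decomposition n B U (\<lambda>i. d i powr p)"
    and sB2: "spectral_decomposition n B2 U (\<lambda>i. d i powr (2 * p))"
    unfolding S_def B_def B2_def by (auto intro!: spectral_decomposition_mat_powr A(1,2))
  have sSS: "spectral_decomposition n (S * S) U (\<lambda>i. d i powr (p - 1) * d i powr (p - 1))"
    by (rule spectral_decomposition_mult[OF sS sS])
  have AS: "A * S = B"
  proof (rule spectral_decomposition_unique[OF _ sB])
    show "spectral_decomposition n (A * S) U (\<lambda>i. d i powr p)"
      by (rule spectral_decomposition_cong[OF spectral_decomposition_mult[OF A(1) sS]])
        (use A(2) powr_mult_base[of "d _" "p - 1"] in auto)
  qed
  have BB: "B * B = B2"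
  proof (rule spectral_decomposition_unique[OF _ sB2])
    show "spectral_decomposition n (B * B) U (\<lambda>i. d i powr (2 * p))"
      by (rule spectral_decomposition_cong[OF spectral_decomposition_mult[OF sB sB]])
        (simp flip: powr_add)
  qed
  have SSq: "mat_powr (S * S) q = B2"
  proof (rule spectral_decomposition_unique[OF _ sB2])
    have "(d i powr (p - 1) * d i powr (p - 1)) powr q = d i powr (2 * p)" for i
    proof -
      have "(p - 1 + (p - 1)) * q = 2 * p" using p by (simp add: q_def field_simps)
      thus ?thesis by (simp add: powr_powr flip: powr_add)
    qed
    thus "spectral_decomposition n (mat_powr (S * S) q) U (\<lambda>i. d i powr (2 * p))"
      using spectral_decomposition_mat_powr[OF sSS, of q] by simp
  qed
  note DA = spectral_decompositionD[OF A(1)] and DZ = spectral_decompositionD[OF Z(1)]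
    and DS = spectral_decompositionD[OF sS] and DB = spectral_decompositionD[OF sB]
    and DB2 = spectral_decompositionD[OF sB2] and DX = spectral_decompositionD[OF X]
    and DY = spectral_decompositionD[OF Y(1)] and DSS = spectral_decompositionD[OF sSS]
  have sZp: "spectral_decomposition n (mat_powr Z p) V (\<lambda>i. z i powr p)"
    by (rule spectral_decomposition_mat_powr[OF Z])
  note DZp = spectral_decompositionD[OF sZp]
  have sYp: "spectral_decomposition n (mat_powr (A * Z * A) p) P (\<lambda>i. y i powr p)"
    by (rule spectral_decomposition_mat_powr[OF Y(1,2)])
  \<comment> \<open>The first $k$ columns of $F$ span the same space as those of $Q$, and $S$ maps them to
    orthogonal vectors.\<close>
  obtain F where F: "unitary n F"
    and off: "\<And>i j. i < k \<Longrightarrow> j < k \<Longrightarrow> i \<noteq> j \<Longrightarrow> (mat_adjoint F * (S * S * F)) $$ (i, j) = 0"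
    and tr: "\<And>T. T \<in> carrier_mat n n \<Longrightarrow> (\<Sum>i<k. quad T F i) = (\<Sum>i<k. quad T Q i)"
    using exists_compression_diagonalizer[OF DX(1) DSS(4,6) k] by metis
  have Fc: "F \<in> carrier_mat n n" "mat_adjoint F \<in> carrier_mat n n"
    using F by (auto intro: unitary_carrier_adjoint)
  have F1: "quad (1\<^sub>m n) F i = 1" if "i < n" for i
    using Fc unitary_left[OF F] that by (simp add: quad_def left_mult_one_mat[of _ n n] del: index_mult_mat)
  define G where "G = S * F"
  have Gc: "G \<in> carrier_mat n n" using DS Fc by (simp add: G_def)
  define m where "m i = quad (1\<^sub>m n) G i" for i
  have GG: "mat_adjoint G * G = mat_adjoint F * (S * S * F)"
    using DS(4,6) Fc by (simp add: G_def mat_adjoint_mult[of _ n n _ n] square_mult[where n=n] square_assoc[where n=n])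
  have m_SS: "m i = quad (S * S) F i" for i
    using Gc GG by (simp add: m_def quad_def left_mult_one_mat[of _ n n] del: index_mult_mat)
  have m0: "m i \<ge> 0" if "i < n" for i
    unfolding m_SS by (rule quad_nonneg[OF sSS _ Fc(1) that]) simp
  \<comment> \<open>If $m_i = 0$ then $s_i = 1 / 0 = 0$ and column $i$ of $K$ vanishes; the other ones of the
    first $k$ columns are orthonormal.\<close>
  define s where "s i = 1 / sqrt (m i)" for i
  define K where "K = G * mat_diag n (\<lambda>i. complex_of_real (s i))"
  have Kc: "K \<in> carrier_mat n n" using Gc by (simp add: K_def)
  have K: "quad T K i = quad T G i / m i" if "T \<in> carrier_mat n n" "i < n" for T i
    unfolding K_def quad_scale[OF that(1) Gc that(2)] using m0[OF that(2)]
    by (simp add: s_def power_divide)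
  have le: "quad (mat_powr A p * mat_powr Z p * mat_powr A p) F i \<le>
      quad (mat_powr (A * Z * A) p) K i + C * quad B2 F i" if i: "i < n" for i
  proof -
    define v where "v = quad (A * Z * A) K i"
    have v: "v \<ge> 0" unfolding v_def by (rule quad_nonneg[OF Y(1,2) Kc i])
    have "quad (mat_powr A p * mat_powr Z p * mat_powr A p) F i = quad (mat_powr Z p) (B * F) i"
      using quad_congruence[OF DZp(4) DB(4) Fc(1)] by (simp add: DB(6) flip: B_def)
    also have "\<dots> \<le> \<alpha> * quad Z (B * F) i + \<beta> * quad (1\<^sub>m n) (B * F) i"
      using DB(4) Fc(1) i by (intro quad_powr_le_linear[OF Z chord]) auto
    also have "B * F = A * G"
      using DA(4) DS(4) Fc(1) by (simp add: G_def square_assoc[where n=n] flip: AS)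
    also have "quad Z (A * G) i = quad (A * Z * A) G i"
      using quad_congruence[OF DZ(4) DA(4) Gc] by (simp add: DA(6))
    also have "A * G = B * F"
      using DA(4) DS(4) Fc(1) by (simp add: G_def square_assoc[where n=n] flip: AS)
    also have "quad (1\<^sub>m n) (B * F) i = quad B2 F i"
      using quad_congruence[OF one_carrier_mat DB(4) Fc(1)] DB(4)
      by (simp add: DB(6) BB right_mult_one_mat[of _ n n])
    also have "quad (A * Z * A) G i = m i * v"
      using quad_one_eq_0[OF Y(1) Gc i] K[OF DY(4) i] by (cases "m i = 0") (simp_all add: v_def m_def)
    finally have 1: "quad (mat_powr A p * mat_powr Z p * mat_powr A p) F i \<le> \<alpha> * (m i * v) + \<beta> * quad B2 F i" .
    have 2: "\<alpha> * (m i * v) \<le> v powr p + c * m i powr q"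
      using young_scaled[OF \<alpha> m0[OF i] v p] by (simp add: c_def q_def mult.assoc)
    have 3: "v powr p \<le> quad (mat_powr (A * Z * A) p) K i"
    proof (cases "m i = 0")
      case True
      hence "v = 0" using K[OF DY(4) i] by (simp add: v_def)
      thus ?thesis using quad_nonneg[OF sYp _ Kc i] by simp
    next
      case False
      hence "quad (1\<^sub>m n) K i = 1" using K[OF one_carrier_mat i] by (simp add: m_def)
      thus ?thesis unfolding v_def by (intro quad_powr_le[OF Y(1,2) Kc i _ p])
    qed
    have "m i powr q \<le> quad B2 F i"
      unfolding m_SS SSq[symmetric] by (rule quad_powr_le[OF sSS _ Fc(1) i F1[OF i] q]) simp
    hence 4: "c * m i powr q \<le> c * quad B2 F i"
      using p by (intro mult_left_mono) (simp_all add: c_def)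
    show ?thesis using 1 2 3 4 unfolding Cc distrib_right by linarith
  qed
  have "(\<Sum>i<k. x i) = (\<Sum>i<k. quad (mat_powr A p * mat_powr Z p * mat_powr A p) Q i)"
    using quad_eigenvector[OF X] k by (intro sum.cong) auto
  also have "\<dots> = (\<Sum>i<k. quad (mat_powr A p * mat_powr Z p * mat_powr A p) F i)"
    by (rule tr[OF DX(4), symmetric])
  also have "\<dots> \<le> (\<Sum>i<k. quad (mat_powr (A * Z * A) p) K i + C * quad B2 F i)"
    using le k by (intro sum_mono) auto
  finally have 1: "(\<Sum>i<k. x i) \<le> (\<Sum>i<k. quad (mat_powr (A * Z * A) p) K i) + C * (\<Sum>i<k. quad B2 F i)"
    by (simp add: sum.distrib sum_distrib_left)
  have 2: "(\<Sum>i<k. quad (mat_powr (A * Z * A) p) K i) \<le> (\<Sum>i<k. y i powr p)"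
  proof (rule ky_fan_sum_le[OF sYp _ _ Kc k, where r = "\<lambda>i. if m i = 0 then 0 else 1"])
    show "y j powr p \<le> y i powr p" if "i \<le> j" "j < n" for i j
      using Y(2,3) that p by (intro powr_mono2) auto
    fix i j assume ij: "i < k" "j < k"
    have "mat_adjoint K * K = mat_diag n (\<lambda>i. complex_of_real (s i)) * (mat_adjoint G * G) * mat_diag n (\<lambda>i. complex_of_real (s i))"
      using Gc mat_adjoint_carrier[OF Gc]
      by (simp add: K_def mat_adjoint_mult[of _ n n _ n] square_mult[where n=n] square_assoc[where n=n])
    hence KK: "(mat_adjoint K * K) $$ (i, j) = complex_of_real (s i) * (mat_adjoint F * (S * S * F)) $$ (i, j) * complex_of_real (s j)"
      using ij k Fc DSS(4) unfolding GG
      by (simp add: mat_diag_mult_left[of _ n n] mat_diag_mult_right[of _ n n] del: index_mult_mat(1))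
    show "(mat_adjoint K * K) $$ (i, j) = (if i = j then complex_of_real (if m i = 0 then 0 else 1) else 0)"
    proof (cases "i = j")
      case True
      have "(mat_adjoint F * (S * S * F)) $$ (i, i) = complex_of_real (m i)"
        using quad_complex[OF DSS(4,6) Fc(1)] ij k by (simp add: m_SS)
      moreover have "s i * m i * s i = (if m i = 0 then 0 else 1)"
        using m0[of i] ij k by (simp add: s_def field_simps)
      ultimately show ?thesis using True unfolding KK
        by (simp del: index_mult_mat flip: of_real_mult)
    next
      case False
      thus ?thesis unfolding KK using off[OF ij] by (simp del: index_mult_mat)
    qed
  qed auto
  have 3: "(\<Sum>i<k. quad B2 F i) \<le> (\<Sum>i<k. d i powr (2 * p))"
  proof (rule ky_fan_sum_le[OF sB2 _ _ Fc(1) k, where r = "\<lambda>_. 1"])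
    show "d j powr (2 * p) \<le> d i powr (2 * p)" if "i \<le> j" "j < n" for i j
      using A(2,3) that p by (intro powr_mono2) auto
  qed (use k unitary_left[OF F] in auto)
  have "C * (\<Sum>i<k. quad B2 F i) \<le> C * (\<Sum>i<k. d i powr (2 * p))"
    by (rule mult_left_mono[OF 3 C(2)])
  with 1 2 show ?thesis by (simp add: sum.distrib sum_distrib_left)
qed

lemma eigenvalue_spectral:
  assumes U: "spectral_decomposition n H U d"
  shows "eigenvalue H e \<longleftrightarrow> (\<exists>i<n. e = complex_of_real (d i))"
proof -
  note D = spectral_decompositionD[OF U]
  let ?D = "mat_diag n (\<lambda>i. complex_of_real (d i))"
  have "similar_mat_wit H ?D U (mat_adjoint U)"
    using D unitary_left[OF D(1)] unitary_right[OF D(1)] by (intro similar_mat_witI[of _ _ n]) auto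
  hence "char_poly H = char_poly ?D"
    by (intro char_poly_similar) (auto simp: similar_mat_def)
  also have "\<dots> = (\<Prod>a\<leftarrow>diag_mat ?D. [:- a, 1:])"
    by (rule char_poly_upper_triangular) (auto simp: mat_diag_def)
  also have "diag_mat ?D = map (\<lambda>i. complex_of_real (d i)) [0..<n]"
    by (auto simp: diag_mat_def mat_diag_def)
  finally have "char_poly H = (\<Prod>a\<leftarrow>map (\<lambda>i. complex_of_real (d i)) [0..<n]. [:- a, 1:])" .
  thus ?thesis
    unfolding eigenvalue_root_char_poly[OF D(4)]
    by (auto simp: poly_prod_list prod_list_zero_iff)
qed

lemma powr_chord_le:
  fixes a b z p :: real
  assumes "0 \<le> b" "b \<le> z" "z \<le> a" "b < a" "p > 1"
  shows "z powr p \<le> (a powr p - b powr p) / (a - b) * z + (a * b powr p - b * a powr p) / (a - b)"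
proof -
  define g where "g = p * z powr (p - 1)"
  have "(z - b) * (z powr p + g * (a - z)) \<le> (z - b) * a powr p"
    unfolding g_def using assms by (intro mult_left_mono powr_tangent_le) auto
  moreover have "(a - z) * (z powr p + g * (b - z)) \<le> (a - z) * b powr p"
    unfolding g_def using assms by (intro mult_left_mono powr_tangent_le) auto
  ultimately have "(a - b) * z powr p \<le> (z - b) * a powr p + (a - z) * b powr p"
    by (simp add: algebra_simps)
  hence "z powr p \<le> ((z - b) * a powr p + (a - z) * b powr p) / (a - b)"
    using assms by (simp add: field_simps)
  also have "\<dots> = (a powr p - b powr p) / (a - b) * z + (a * b powr p - b * a powr p) / (a - b)"
    using assms by (simp add: divide_simps) (simp add: algebra_simps)
  finally show ?thesis .
qed

theorem theorem3p4:
  fixes n :: nat and A Z :: "complex mat" and a b p :: real and N :: "complex mat \<Rightarrow> real"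
  assumes "psd n A" and "psd n Z"
    and "largest_eigenvalue Z a" and "smallest_eigenvalue Z b"
    and "symmetric_norm n N"
    and "p > 1"
  shows "N (mat_powr A p * mat_powr Z p * mat_powr A p) - N (mat_powr (A * Z * A) p)
         \<le> C_const a b p * N (mat_powr A (2 * p))"
proof -
  note N = assms(5) and p = assms(6)
  obtain U d where A: "spectral_decomposition n A U d" "\<And>i. i < n \<Longrightarrow> 0 \<le> d i"
    "\<And>i j. i \<le> j \<Longrightarrow> j < n \<Longrightarrow> d j \<le> d i"
    by (metis exists_psd_decomposition[OF assms(1)])
  obtain V z where Z: "spectral_decomposition n Z V z" "\<And>i. i < n \<Longrightarrow> 0 \<le> z i"
    by (metis exists_psd_decomposition[OF assms(2)])
  note DA = spectral_decompositionD[OF A(1)]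
  note sA = spectral_decomposition_mat_powr[OF A(1,2)]
  note sZ = spectral_decomposition_mat_powr[OF Z(1,2)]
  have "psd n (A * Z * A)"
    using psd_congruence[OF assms(2) DA(4)] by (simp add: DA(6))
  then obtain P y where Y: "spectral_decomposition n (A * Z * A) P y" "\<And>i. i < n \<Longrightarrow> 0 \<le> y i"
    "\<And>i j. i \<le> j \<Longrightarrow> j < n \<Longrightarrow> y j \<le> y i"
    by (metis exists_psd_decomposition)
  have "psd n (mat_powr Z p)"
    by (rule spectral_decomposition_psd[OF sZ]) auto
  hence "psd n (mat_powr A p * mat_powr Z p * mat_powr A p)"
    using psd_congruence[of n "mat_powr Z p" "mat_powr A p"] spectral_decompositionD(4,6)[OF sA, of p]
    by simp
  then obtain Q x where X: "spectral_decomposition n (mat_powr A p * mat_powr Z p * mat_powr A p) Q x"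
    "\<And>i. i < n \<Longrightarrow> 0 \<le> x i" "\<And>i j. i \<le> j \<Longrightarrow> j < n \<Longrightarrow> x j \<le> x i"
    by (metis exists_psd_decomposition)
  have z: "b \<le> z i" "z i \<le> a" if "i < n" for i
    using assms(3,4) that eigenvalue_spectral[OF Z(1)]
    unfolding largest_eigenvalue_def smallest_eigenvalue_def by blast+
  obtain ia where ia: "ia < n" "z ia = a"
    using assms(3) eigenvalue_spectral[OF Z(1)] by (auto simp: largest_eigenvalue_def)
  obtain ib where ib: "ib < n" "z ib = b"
    using assms(4) eigenvalue_spectral[OF Z(1)] by (auto simp: smallest_eigenvalue_def)
  have b: "0 \<le> b" and a: "0 \<le> a" "b \<le> a" using Z(2) z ia ib by auto
  \<comment> \<open>The chord of $t^p$ over $[b, a]$, or its tangent if $a = b$.\<close>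
  define \<alpha> where "\<alpha> = (if a = b then p * a powr (p - 1) else (a powr p - b powr p) / (a - b))"
  define \<beta> where "\<beta> = (if a = b then (1 - p) * a powr p else (a * b powr p - b * a powr p) / (a - b))"
  have \<alpha>: "\<alpha> \<ge> 0"
    using a b p by (auto simp: \<alpha>_def intro!: divide_nonneg_nonneg powr_mono2)
  have C: "C_const a b p = (p - 1) * (\<alpha> / p) powr (p / (p - 1)) + \<beta>"
  proof (cases "a = b")
    case True
    have "(\<alpha> / p) powr (p / (p - 1)) = a powr p"
      using True p by (simp add: \<alpha>_def powr_powr)
    thus ?thesis using True by (simp add: C_const_def \<beta>_def algebra_simps)
  next
    case False
    thus ?thesis by (simp add: C_const_def \<alpha>_def \<beta>_def mult.commute)
  qed
  have chord: "z i powr p \<le> \<alpha> * z i + \<beta>" if i: "i < n" for i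
  proof (cases "a = b")
    case True
    have zi: "z i = a" using z[OF i] True by simp
    have "\<alpha> * z i + \<beta> = p * (a * a powr (p - 1)) + (1 - p) * a powr p"
      using True by (simp add: \<alpha>_def \<beta>_def zi)
    also have "a * a powr (p - 1) = a powr p"
      using a powr_mult_base[of a "p - 1"] by simp
    finally show ?thesis by (simp add: zi algebra_simps)
  next
    case False
    thus ?thesis using powr_chord_le[OF b z[OF i] _ p] a(2) by (simp add: \<alpha>_def \<beta>_def)
  qed
  have "\<alpha> * 1 * a \<le> a powr p + (p - 1) * (\<alpha> / p) powr (p / (p - 1)) * 1 powr (p / (p - 1))"
    using \<alpha> a p by (intro young_scaled) auto
  hence C0: "C_const a b p \<ge> 0"
    using chord[OF ia(1)] ia(2) by (simp add: C)
  let ?D = "\<lambda>f. mat_diag n (\<lambda>i. complex_of_real (f i))"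
  have "N (mat_powr A p * mat_powr Z p * mat_powr A p) = N (?D x)"
    by (rule symmetric_norm_spectral[OF N X(1)])
  also have "\<dots> \<le> N (?D (\<lambda>i. y i powr p + C_const a b p * d i powr (2 * p)))"
    by (rule ky_fan_dominance[OF N X(2,3)], assumption+)
      (rule eigenvalue_partial_sums_le[OF A Z Y X(1) p \<alpha> chord C C0], assumption+)
  also have "\<dots> \<le> N (?D (\<lambda>i. y i powr p)) + C_const a b p * N (?D (\<lambda>i. d i powr (2 * p)))"
    using symmetric_norm_diag_linear_le[OF N zero_le_one C0, of "\<lambda>i. y i powr p"] by simp
  also have "N (?D (\<lambda>i. y i powr p)) = N (mat_powr (A * Z * A) p)"
    by (rule symmetric_norm_spectral[OF N spectral_decomposition_mat_powr[OF Y(1,2)], symmetric])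
  also have "N (?D (\<lambda>i. d i powr (2 * p))) = N (mat_powr A (2 * p))"
    by (rule symmetric_norm_spectral[OF N sA, symmetric])
  finally show ?thesis by simp
qed

end
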